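(* Let $n\ge3$ and $k\ge1$. (i) $H_{n,k,\mathrm{sol}}=H_{n,k,1}\oplus H_{n,k,2}$, where $H_{n,k,1}:=\{w\in H_{n,k,\mathrm{sol}}:A(w)=-k\,w\}$ is the eigenspace of $A$ for the eigenvalue $-k$ and $H_{n,k,2}:=\{w\in H_{n,k,\mathrm{sol}}:A(w)=w\}$ the eigenspace for the eigenvalue $1$. (ii) The subspace $H_{n,k,3}:=H_{n,k,\mathrm{sol}}^\perp$ is an eigenspace of $A$ with eigenvalue $k+n-2$, i.e. $A(w)=(k+n-2)w$ for all $w\in H_{n,k,\mathrm{sol}}^\perp$.
   Context: $\mathbb S^{n-1}\subset\mathbb R^n$ unit sphere, $B_1$ unit ball; $\mathrm{Av}(f):=\frac{1}{\mathcal H^{n-1}(\mathbb S^{n-1})}\int_{\mathbb S^{n-1}}f\,d\mathcal H^{n-1}$. $\{\tau_i\}$ local orthonormal tangent frame; $\nabla_T w^j$ is the tangential gradient vector of the $j$-th component of $w$, $\mathrm{div}_{\mathbb S^{n-1}}w:=\sum_i\langle\partial_{\tau_i}w,\tau_i\rangle$; $w_h$ is the componentwise harmonic extension of $w$ to $\overline{B_1}$. $H_n:=\{w\in W^{1,2}(\mathbb S^{n-1};\mathbb R^n):\mathrm{Av}(w)=0,\ \mathrm{Av}(\langle w,x\rangle)=0\}$; $A(w):=(\mathrm{div}_{\mathbb S^{n-1}}w)x-\sum_{j=1}^n x_j\nabla_T w^j$. $H_{n,k}$ is the subspace of $H_n$ of maps whose components are all $k$-th order spherical harmonics (restrictions of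 homogeneous harmonic polynomials of degree $k$); $H_{n,k,\mathrm{sol}}:=\{w\in H_{n,k}:\mathrm{div}\,w_h\equiv0\text{ in }B_1\}$ and $H_{n,k,\mathrm{sol}}^\perp$ is its $W^{1,2}$-orthogonal complement in $H_{n,k}$. *)

theory Defs
  imports "HOL-Analysis.Analysis"
begin

definition pd :: "'n::finite \<Rightarrow> (real^'n \<Rightarrow> real) \<Rightarrow> real^'n \<Rightarrow> real" where
  "pd i f x = deriv (\<lambda>t. f (x + t *\<^sub>R axis i 1)) 0"

definition laplacian :: "(real^'n::finite \<Rightarrow> real) \<Rightarrow> real^'n \<Rightarrow> real" where
  "laplacian f x = (\<Sum>i\<in>UNIV. pd i (pd i f) x)"

definition harmonic_on :: "(real^'n::finite) set \<Rightarrow> (real^'n \<Rightarrow> real) \<Rightarrow> bool" where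
  "harmonic_on S f \<longleftrightarrow>
     f differentiable_on S \<and>
     (\<forall>i. pd i f differentiable_on S) \<and>
     (\<forall>i j. continuous_on S (pd j (pd i f))) \<and>
     (\<forall>x\<in>S. laplacian f x = 0)"

definition hom_poly :: "nat \<Rightarrow> (real^'n::finite \<Rightarrow> real) \<Rightarrow> bool" where
  "hom_poly k p \<longleftrightarrow> (\<exists>(A :: ('n \<Rightarrow> nat) set) c. finite A \<and> (\<forall>\<alpha>\<in>A. sum \<alpha> UNIV = k) \<and>
      p = (\<lambda>x. \<Sum>\<alpha>\<in>A. c \<alpha> * (\<Prod>i\<in>UNIV. (x $ i) ^ (\<alpha> i))))"

definition hom_harm_poly :: "nat \<Rightarrow> (real^'n::finite \<Rightarrow> real) \<Rightarrow> bool" where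
  "hom_harm_poly k p \<longleftrightarrow> hom_poly k p \<and> (\<forall>x. laplacian p x = 0)"

definition sph_harm :: "nat \<Rightarrow> (real^'n::finite \<Rightarrow> real) \<Rightarrow> bool" where
  "sph_harm k f \<longleftrightarrow> (\<exists>p. hom_harm_poly k p \<and> (\<forall>x\<in>sphere 0 1. f x = p x))"

text \<open>Surface measure on the sphere via the cone construction:
  int_S f dH^{n-1} = n * int_{B_1} f(x/|x|) dx.\<close>
definition sph_int :: "(real^'n::finite \<Rightarrow> 'b::euclidean_space) \<Rightarrow> 'b" where
  "sph_int f = real CARD('n) *\<^sub>R integral (ball 0 1) (\<lambda>x. f (x /\<^sub>R norm x))"

definition Av :: "(real^'n::finite \<Rightarrow> 'b::euclidean_space) \<Rightarrow> 'b" where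
  "Av f = sph_int f /\<^sub>R sph_int (\<lambda>x::real^'n. 1::real)"

definition tframe :: "real^'n::finite \<Rightarrow> (real^'n) set" where
  "tframe x = (SOME B. B \<subseteq> {v. v \<bullet> x = 0} \<and> pairwise orthogonal B \<and>
                      (\<forall>v\<in>B. norm v = 1) \<and> span B = {v. v \<bullet> x = 0})"

text \<open>Derivative of a function defined on the sphere along the tangent vector tau at x,
  computed along the sphere curve t -> (x + t tau)/|x + t tau|.\<close>
definition dT :: "real^'n::finite \<Rightarrow> (real^'n \<Rightarrow> 'b::real_normed_vector) \<Rightarrow> real^'n \<Rightarrow> 'b" where
  "dT tau f x = vector_derivative (\<lambda>t. f ((x + t *\<^sub>R tau) /\<^sub>R norm (x + t *\<^sub>R tau))) (at 0)"

definition gradT :: "(real^'n::finite \<Rightarrow> real) \<Rightarrow> real^'n \<Rightarrow> real^'n" where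
  "gradT f x = (\<Sum>tau\<in>tframe x. dT tau f x *\<^sub>R tau)"

definition divS :: "(real^'n::finite \<Rightarrow> real^'n) \<Rightarrow> real^'n \<Rightarrow> real" where
  "divS w x = (\<Sum>tau\<in>tframe x. dT tau w x \<bullet> tau)"

definition opA :: "(real^'n::finite \<Rightarrow> real^'n) \<Rightarrow> real^'n \<Rightarrow> real^'n" where
  "opA w x = divS w x *\<^sub>R x - (\<Sum>j\<in>UNIV. (x $ j) *\<^sub>R gradT (\<lambda>y. w y $ j) x)"

definition ip12 :: "(real^'n::finite \<Rightarrow> real^'n) \<Rightarrow> (real^'n \<Rightarrow> real^'n) \<Rightarrow> real" where
  "ip12 u v = sph_int (\<lambda>x. u x \<bullet> v x +
       (\<Sum>j\<in>UNIV. gradT (\<lambda>y. u y $ j) x \<bullet> gradT (\<lambda>y. v y $ j) x))"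

definition harm_ext :: "(real^'n::finite \<Rightarrow> real) \<Rightarrow> real^'n \<Rightarrow> real" where
  "harm_ext f = (THE u. continuous_on (cball 0 1) u \<and> harmonic_on (ball 0 1) u \<and>
                        (\<forall>x\<in>sphere 0 1. u x = f x) \<and> (\<forall>x. x \<notin> cball 0 1 \<longrightarrow> u x = 0))"

definition harm_ext_vec :: "(real^'n::finite \<Rightarrow> real^'n) \<Rightarrow> real^'n \<Rightarrow> real^'n" where
  "harm_ext_vec w x = (\<chi> j. harm_ext (\<lambda>y. w y $ j) x)"

definition vdiv :: "(real^'n::finite \<Rightarrow> real^'n) \<Rightarrow> real^'n \<Rightarrow> real" where
  "vdiv u x = (\<Sum>j\<in>UNIV. pd j (\<lambda>y. u y $ j) x)"

definition Hn :: "(real^'n::finite \<Rightarrow> real^'n) set" where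
  "Hn = {w. Av w = 0 \<and> Av (\<lambda>x. w x \<bullet> x) = 0}"

definition Hnk :: "nat \<Rightarrow> (real^'n::finite \<Rightarrow> real^'n) set" where
  "Hnk k = {w \<in> Hn. \<forall>j. sph_harm k (\<lambda>x. w x $ j)}"

definition Hsol :: "nat \<Rightarrow> (real^'n::finite \<Rightarrow> real^'n) set" where
  "Hsol k = {w \<in> Hnk k. \<forall>x\<in>ball 0 1. vdiv (harm_ext_vec w) x = 0}"

definition Hsol_perp :: "nat \<Rightarrow> (real^'n::finite \<Rightarrow> real^'n) set" where
  "Hsol_perp k = {w \<in> Hnk k. \<forall>v\<in>Hsol k. ip12 w v = 0}"

definition H1 :: "nat \<Rightarrow> (real^'n::finite \<Rightarrow> real^'n) set" where
  "H1 k = {w \<in> Hsol k. \<forall>x\<in>sphere 0 1. opA w x = (- real k) *\<^sub>R w x}"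

definition H2 :: "nat \<Rightarrow> (real^'n::finite \<Rightarrow> real^'n) set" where
  "H2 k = {w \<in> Hsol k. \<forall>x\<in>sphere 0 1. opA w x = w x}"

end

theory Submission
  imports Defs
begin

text \<open>On the sphere, a map \<open>w\<close> whose components are restrictions of homogeneous polynomials
  \<open>P\<^sub>j\<close> satisfies \<open>A(w) = (div P) x - \<nabla>\<langle>x, P\<rangle> + P\<close>. If \<open>P\<close> is harmonic and \<open>div P = 0\<close>, then
  \<open>f = \<langle>x, P\<rangle>\<close> is harmonic of degree \<open>k + 1\<close>, \<open>\<nabla>f / (k + 1)\<close> is an eigenvector for \<open>-k\<close>, and
  \<open>P - \<nabla>f / (k + 1)\<close> is pointwise tangential and hence fixed by \<open>A\<close>. In general, if \<open>q\<close> is a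
  suitable multiple of \<open>div P\<close>, the harmonic projection \<open>W\<close> of \<open>x q\<close> has the same divergence as \<open>P\<close>
  and is an eigenvector for \<open>k + n - 2\<close>; it is orthogonal to all solenoidal maps because spherical
  harmonics of different degrees are orthogonal. So \<open>P - W\<close> is the solenoidal part of \<open>P\<close>.

  All integral identities come from \<open>\<integral>\<^sub>S \<partial>\<^sub>i h = (n + e - 1) \<integral>\<^sub>S x\<^sub>i h\<close> for homogeneous \<open>h\<close> of degree
  \<open>e\<close>. This is obtained by integrating \<open>\<partial>\<^sub>i((1 - |x|\<^sup>2)\<^sub>+\<^sup>2 h)\<close> over the whole space and converting ball
  integrals of homogeneous polynomials into sphere integrals.\<close>

section \<open>Partial derivatives of polynomial functions\<close>

lemma real_polynomial_function_component:
  "real_polynomial_function (\<lambda>x::real^'n. x $ i)"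
  by (rule real_polynomial_function.intros(1)) (rule bounded_linear_vec_nth)

lemmas rpf_intros = real_polynomial_function.intros(2) real_polynomial_function.intros(3)
  real_polynomial_function.intros(4) real_polynomial_function_component
  real_polynomial_function_sum real_polynomial_function_prod real_polynomial_function_power
  real_polynomial_function_diff real_polynomial_function_minus real_polynomial_function_divide

lemma pd_eqI:
  assumes "((\<lambda>t. f (x + t *\<^sub>R axis i 1)) has_real_derivative D) (at 0)"
  shows "pd i f x = D"
  unfolding pd_def by (rule DERIV_imp_deriv) (fact assms)

lemma has_derivative_imp_line_derivative:
  fixes f :: "'a::real_normed_vector \<Rightarrow> real"
  assumes "(f has_derivative f') (at x)"
  shows "((\<lambda>t. f (x + t *\<^sub>R v)) has_real_derivative f' v) (at 0)"
proof -
  have "((\<lambda>t. x + t *\<^sub>R v) has_derivative (\<lambda>t. t *\<^sub>R v)) (at 0)"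
    by (auto intro!: derivative_eq_intros)
  from has_derivative_compose[OF this, of f f'] assms
  have "((\<lambda>t. f (x + t *\<^sub>R v)) has_derivative (\<lambda>t. f' (t *\<^sub>R v))) (at 0)" by simp
  moreover have "f' (t *\<^sub>R v) = f' v * t" for t
    using linear_cmul[OF has_derivative_linear[OF assms]] by simp
  ultimately show ?thesis by (simp add: has_field_derivative_def)
qed

lemma has_derivative_pd:
  fixes p :: "real^'n \<Rightarrow> real"
  assumes "real_polynomial_function p"
  shows "(p has_derivative (\<lambda>v. \<Sum>i\<in>UNIV. v $ i * pd i p x)) (at x)"
proof -
  obtain p' where p': "(p has_derivative p') (at x)"
    using differentiable_at_real_polynomial_function[OF assms] by (auto simp: differentiable_def)
  have eq: "pd i p x = p' (axis i 1)" for i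
    by (intro pd_eqI has_derivative_imp_line_derivative p')
  have "p' v = (\<Sum>i\<in>UNIV. v $ i * p' (axis i 1))" for v
  proof -
    have "p' v = p' (\<Sum>i\<in>UNIV. (v $ i) *\<^sub>R axis i 1)"
      using basis_expansion[of v] by (simp add: scalar_mult_eq_scaleR)
    also have "\<dots> = (\<Sum>i\<in>UNIV. v $ i * p' (axis i 1))"
      using has_derivative_linear[OF p'] by (simp add: linear_sum linear_cmul)
    finally show ?thesis .
  qed
  then have "p' = (\<lambda>v. \<Sum>i\<in>UNIV. v $ i * pd i p x)"
    unfolding eq by (rule ext)
  then show ?thesis using p' by simp
qed

text \<open>Moving the base point along the axis turns the derivative at 0 in \<open>pd\<close> into
  one at any \<open>t\<close>. Both the cutoff argument and the maximum principle need the
  derivative along a whole segment.\<close>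

lemma differentiable_has_real_derivative_pd:
  fixes f :: "real^'n \<Rightarrow> real"
  assumes "f differentiable at (x + t *\<^sub>R axis i 1)"
  shows "((\<lambda>t. f (x + t *\<^sub>R axis i 1)) has_real_derivative pd i f (x + t *\<^sub>R axis i 1)) (at t)"
proof -
  let ?y = "x + t *\<^sub>R axis i 1"
  obtain f' where "(f has_derivative f') (at ?y)"
    using assms by (auto simp: differentiable_def)
  then have "((\<lambda>s. f (?y + s *\<^sub>R axis i 1)) has_real_derivative f' (axis i 1)) (at 0)"
    by (rule has_derivative_imp_line_derivative)
  moreover from this have "pd i f ?y = f' (axis i 1)" by (rule pd_eqI)
  ultimately have "((\<lambda>s. f (x + (s + t) *\<^sub>R axis i 1)) has_real_derivative pd i f ?y) (at 0)"
    by (simp add: scaleR_left_distrib add_ac)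
  then show ?thesis
    using DERIV_shift[of "\<lambda>t. f (x + t *\<^sub>R axis i 1)" _ 0 t] by simp
qed

lemma has_real_derivative_pd:
  fixes p :: "real^'n \<Rightarrow> real"
  assumes "real_polynomial_function p"
  shows "((\<lambda>t. p (x + t *\<^sub>R axis i 1)) has_real_derivative pd i p x) (at 0)"
  using differentiable_has_real_derivative_pd[of p x 0 i]
    differentiable_at_real_polynomial_function[OF assms] by simp

lemma pd_const [simp]: "pd i (\<lambda>x. c) = (\<lambda>x. 0)"
  by (rule ext) (auto intro!: pd_eqI derivative_eq_intros)

lemma pd_component: "pd i (\<lambda>x::real^'n. x $ j) = (\<lambda>x. if i = j then 1 else 0)"
  by (rule ext) (auto intro!: pd_eqI derivative_eq_intros simp: axis_def)

lemma pd_add: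
  fixes p q :: "real^'n \<Rightarrow> real"
  assumes "real_polynomial_function p" "real_polynomial_function q"
  shows "pd i (\<lambda>x. p x + q x) = (\<lambda>x. pd i p x + pd i q x)"
  by (rule ext) (intro pd_eqI DERIV_add has_real_derivative_pd assms)

lemma pd_diff:
  fixes p q :: "real^'n \<Rightarrow> real"
  assumes "real_polynomial_function p" "real_polynomial_function q"
  shows "pd i (\<lambda>x. p x - q x) = (\<lambda>x. pd i p x - pd i q x)"
  by (rule ext) (intro pd_eqI DERIV_diff has_real_derivative_pd assms)

lemma pd_mult:
  fixes p q :: "real^'n \<Rightarrow> real"
  assumes "real_polynomial_function p" "real_polynomial_function q"
  shows "pd i (\<lambda>x. p x * q x) = (\<lambda>x. pd i p x * q x + p x * pd i q x)"
proof
  fix x :: "real^'n"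
  show "pd i (\<lambda>x. p x * q x) x = pd i p x * q x + p x * pd i q x"
    using DERIV_mult[OF has_real_derivative_pd[OF assms(1)] has_real_derivative_pd[OF assms(2)], of x i x i]
    by (intro pd_eqI) (simp add: algebra_simps)
qed

lemma pd_cmult:
  fixes p :: "real^'n \<Rightarrow> real"
  assumes "real_polynomial_function p"
  shows "pd i (\<lambda>x. c * p x) = (\<lambda>x. c * pd i p x)"
  using pd_mult[OF real_polynomial_function.intros(2) assms] by simp

lemma pd_sum:
  fixes p :: "'a \<Rightarrow> real^'n \<Rightarrow> real"
  assumes "finite I" "\<And>j. j \<in> I \<Longrightarrow> real_polynomial_function (p j)"
  shows "pd i (\<lambda>x. \<Sum>j\<in>I. p j x) = (\<lambda>x. \<Sum>j\<in>I. pd i (p j) x)"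
  by (rule ext) (intro pd_eqI DERIV_sum has_real_derivative_pd assms)

lemma real_polynomial_function_pd:
  fixes p :: "real^'n \<Rightarrow> real"
  assumes "real_polynomial_function p"
  shows "real_polynomial_function (pd i p)"
  using assms
proof induction
  case (linear f)
  have "pd i f = (\<lambda>x. f (axis i 1))"
    by (rule ext) (intro pd_eqI has_derivative_imp_line_derivative bounded_linear_imp_has_derivative linear)
  then show ?case by (simp add: rpf_intros)
qed (simp_all add: pd_add pd_mult rpf_intros)

text \<open>Induction over the construction of polynomials replaces Schwarz's theorem: a linear map
  has constant first partials, and the sum and product rules preserve symmetry.\<close>

lemma pd_commute:
  fixes p :: "real^'n \<Rightarrow> real"
  assumes "real_polynomial_function p"
  shows "pd i (pd j p) = pd j (pd i p)"
  using assms
proof induction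
  case (linear f)
  have "pd i f = (\<lambda>x. f (axis i 1))" for i
    by (rule ext) (intro pd_eqI has_derivative_imp_line_derivative bounded_linear_imp_has_derivative linear)
  then show ?case by simp
qed (simp_all add: pd_add pd_mult rpf_intros real_polynomial_function_pd algebra_simps)

section \<open>Algebraic rules for the Laplacian of polynomials\<close>

lemma laplacian_add:
  fixes p q :: "real^'n \<Rightarrow> real"
  assumes "real_polynomial_function p" "real_polynomial_function q"
  shows "laplacian (\<lambda>x. p x + q x) x = laplacian p x + laplacian q x"
  using assms by (simp add: laplacian_def pd_add real_polynomial_function_pd sum.distrib)

lemma laplacian_cmult:
  fixes p :: "real^'n \<Rightarrow> real"
  assumes "real_polynomial_function p"
  shows "laplacian (\<lambda>x. c * p x) x = c * laplacian p x"
  using assms by (simp add: laplacian_def pd_cmult real_polynomial_function_pd sum_distrib_left)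

lemma laplacian_sum:
  fixes p :: "'a \<Rightarrow> real^'n \<Rightarrow> real"
  assumes "finite I" "\<And>j. j \<in> I \<Longrightarrow> real_polynomial_function (p j)"
  shows "laplacian (\<lambda>x. \<Sum>j\<in>I. p j x) x = (\<Sum>j\<in>I. laplacian (p j) x)"
  using assms by (simp add: laplacian_def pd_sum real_polynomial_function_pd) (rule sum.swap)

lemma laplacian_mult:
  fixes p q :: "real^'n \<Rightarrow> real"
  assumes "real_polynomial_function p" "real_polynomial_function q"
  shows "laplacian (\<lambda>x. p x * q x) x =
    laplacian p x * q x + 2 * (\<Sum>i\<in>UNIV. pd i p x * pd i q x) + p x * laplacian q x"
proof -
  have "pd i (pd i (\<lambda>x. p x * q x)) x =
      pd i (pd i p) x * q x + 2 * (pd i p x * pd i q x) + p x * pd i (pd i q) x" for i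
    using assms by (simp add: pd_add pd_mult real_polynomial_function_pd rpf_intros)
  then show ?thesis
    by (simp only: laplacian_def sum.distrib sum_distrib_left sum_distrib_right)
qed

lemma laplacian_pd:
  fixes p :: "real^'n \<Rightarrow> real"
  assumes "real_polynomial_function p"
  shows "laplacian (pd i p) x = pd i (laplacian p) x"
proof -
  have "laplacian p = (\<lambda>x. \<Sum>j\<in>UNIV. pd j (pd j p) x)"
    by (rule ext) (simp add: laplacian_def)
  moreover have "pd j (pd j (pd i p)) = pd i (pd j (pd j p))" for j
    using assms by (metis pd_commute real_polynomial_function_pd)
  ultimately show ?thesis
    using assms by (simp add: laplacian_def pd_sum real_polynomial_function_pd)
qed

section \<open>Homogeneous polynomials\<close>

lemma hom_poly_zero: "hom_poly k (\<lambda>x::real^'n. 0)"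
  unfolding hom_poly_def by (rule exI[of _ "{}"]) simp

lemma hom_poly_monomial:
  assumes "sum \<alpha> UNIV = k"
  shows "hom_poly k (\<lambda>x::real^'n. c * (\<Prod>i\<in>UNIV. (x $ i) ^ (\<alpha> i)))"
  unfolding hom_poly_def using assms
  by (intro exI[of _ "{\<alpha>}"] exI[of _ "\<lambda>_. c"]) simp

lemma hom_poly_add:
  fixes p q :: "real^'n \<Rightarrow> real"
  assumes "hom_poly k p" "hom_poly k q"
  shows "hom_poly k (\<lambda>x. p x + q x)"
proof -
  let ?m = "\<lambda>(\<alpha>::'n \<Rightarrow> nat) (x::real^'n). \<Prod>i\<in>UNIV. (x $ i) ^ (\<alpha> i)"
  obtain A c where A: "finite A" "\<forall>\<alpha>\<in>A. sum \<alpha> UNIV = k" "p = (\<lambda>x. \<Sum>\<alpha>\<in>A. c \<alpha> * ?m \<alpha> x)"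
    using assms(1) unfolding hom_poly_def by blast
  obtain B d where B: "finite B" "\<forall>\<alpha>\<in>B. sum \<alpha> UNIV = k" "q = (\<lambda>x. \<Sum>\<alpha>\<in>B. d \<alpha> * ?m \<alpha> x)"
    using assms(2) unfolding hom_poly_def by blast
  \<comment> \<open>The two exponent sets may overlap, so both coefficient families are extended by
    zero to the union and added there.\<close>
  define e where "e \<alpha> = (if \<alpha> \<in> A then c \<alpha> else 0) + (if \<alpha> \<in> B then d \<alpha> else 0)" for \<alpha>
  have "p x = (\<Sum>\<alpha>\<in>A \<union> B. (if \<alpha> \<in> A then c \<alpha> else 0) * ?m \<alpha> x)" for x
    unfolding A(3) by (rule sum.mono_neutral_cong_left) (auto simp: A B)
  moreover have "q x = (\<Sum>\<alpha>\<in>A \<union> B. (if \<alpha> \<in> B then d \<alpha> else 0) * ?m \<alpha> x)" for x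
    unfolding B(3) by (rule sum.mono_neutral_cong_left) (auto simp: A B)
  ultimately have "(\<lambda>x. p x + q x) = (\<lambda>x. \<Sum>\<alpha>\<in>A \<union> B. e \<alpha> * ?m \<alpha> x)"
    by (simp only: e_def distrib_right sum.distrib)
  then show ?thesis
    unfolding hom_poly_def using A(1,2) B(1,2)
    by (intro exI[of _ "A \<union> B"] exI[of _ e]) auto
qed

lemma hom_poly_sum:
  assumes "\<And>j. j \<in> I \<Longrightarrow> hom_poly k (p j)"
  shows "hom_poly k (\<lambda>x::real^'n. \<Sum>j\<in>I. p j x)"
  using assms by (induction I rule: infinite_finite_induct) (simp_all add: hom_poly_zero hom_poly_add)

text \<open>Hides exponent sets and coefficients: a property of monomials that is stable under sums
  of equal degree holds for all homogeneous polynomials.\<close>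

lemma hom_poly_induct [consumes 1, case_names monomial zero add]:
  fixes p :: "real^'n \<Rightarrow> real"
  assumes "hom_poly k p"
    and monom: "\<And>\<alpha> c. sum \<alpha> UNIV = k \<Longrightarrow> P (\<lambda>x::real^'n. c * (\<Prod>i\<in>UNIV. (x $ i) ^ (\<alpha> i)))"
    and zero: "P (\<lambda>x. 0)"
    and add: "\<And>p q. hom_poly k p \<Longrightarrow> hom_poly k q \<Longrightarrow> P p \<Longrightarrow> P q \<Longrightarrow> P (\<lambda>x. p x + q x)"
  shows "P p"
proof -
  obtain A c where A: "finite A" "\<forall>\<alpha>\<in>A. sum \<alpha> UNIV = k"
    and p: "p = (\<lambda>x. \<Sum>\<alpha>\<in>A. c \<alpha> * (\<Prod>i\<in>UNIV. (x $ i) ^ (\<alpha> i)))"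
    using assms(1) unfolding hom_poly_def by blast
  show ?thesis unfolding p using A
  proof (induction A)
    case (insert \<alpha> A)
    then show ?case
      using add[OF _ _ monom[of \<alpha> "c \<alpha>"] insert.IH]
      by (simp add: hom_poly_monomial hom_poly_sum)
  qed (simp add: zero)
qed

lemma real_polynomial_function_hom_poly:
  fixes p :: "real^'n \<Rightarrow> real"
  assumes "hom_poly k p"
  shows "real_polynomial_function p"
  using assms by (induction rule: hom_poly_induct) (simp_all add: rpf_intros)

lemma hom_poly_mult:
  fixes p q :: "real^'n \<Rightarrow> real"
  assumes "hom_poly k p" "hom_poly l q"
  shows "hom_poly (k + l) (\<lambda>x. p x * q x)"
  using assms(1)
proof (induction rule: hom_poly_induct)
  case (monomial \<alpha> c)
  show ?case using assms(2)
  proof (induction rule: hom_poly_induct)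
    case (monomial \<beta> d)
    have "hom_poly (k + l) (\<lambda>x::real^'n. (c * d) * (\<Prod>i\<in>UNIV. (x $ i) ^ (\<alpha> i + \<beta> i)))"
      using monomial \<open>sum \<alpha> UNIV = k\<close> by (intro hom_poly_monomial) (simp add: sum.distrib)
    then show ?case by (simp add: power_add prod.distrib mult_ac)
  qed (simp_all add: hom_poly_zero distrib_left hom_poly_add)
qed (simp_all add: hom_poly_zero distrib_right hom_poly_add)

lemma hom_poly_const: "hom_poly 0 (\<lambda>x::real^'n. c)"
  using hom_poly_monomial[of "\<lambda>_. 0" 0 c] by simp

lemma hom_poly_cmult:
  fixes p :: "real^'n \<Rightarrow> real"
  shows "hom_poly k p \<Longrightarrow> hom_poly k (\<lambda>x. c * p x)"
  using hom_poly_mult[OF hom_poly_const] by fastforce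

lemma hom_poly_diff:
  fixes p q :: "real^'n \<Rightarrow> real"
  shows "hom_poly k p \<Longrightarrow> hom_poly k q \<Longrightarrow> hom_poly k (\<lambda>x. p x - q x)"
  using hom_poly_add[OF _ hom_poly_cmult[of k q "-1"]] by simp

lemma hom_poly_component: "hom_poly 1 (\<lambda>x::real^'n. x $ i)"
proof -
  have "(\<Prod>j\<in>UNIV. (x $ j) ^ (if j = i then 1 else 0)) = x $ i" for x :: "real^'n"
    by (simp add: if_distrib[of "\<lambda>n. _ ^ n"] cong: if_cong)
  then show ?thesis
    using hom_poly_monomial[of "\<lambda>j. if j = i then 1 else 0" 1 1] by simp
qed

lemma hom_poly_norm_square: "hom_poly 2 (\<lambda>x::real^'n. (norm x)\<^sup>2)"
proof -
  have "hom_poly (1 + 1) (\<lambda>x::real^'n. \<Sum>i\<in>UNIV. x $ i * x $ i)"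
    by (intro hom_poly_sum hom_poly_mult hom_poly_component)
  then show ?thesis
    by (simp add: norm_vec_def L2_set_def power2_eq_square sum_nonneg numeral_2_eq_2)
qed

lemma hom_poly_pd:
  fixes p :: "real^'n \<Rightarrow> real"
  assumes "hom_poly k p"
  shows "hom_poly (k - 1) (pd i p)"
  using assms
proof (induction rule: hom_poly_induct)
  case (monomial \<alpha> c)
  let ?R = "\<lambda>x::real^'n. \<Prod>j\<in>UNIV - {i}. (x $ j) ^ (\<alpha> j)"
  let ?\<beta> = "\<alpha>(i := \<alpha> i - 1)"
  have split: "(\<Prod>j\<in>UNIV. (x $ j) ^ (\<gamma> j)) = (x $ i) ^ (\<gamma> i) * (\<Prod>j\<in>UNIV - {i}. (x $ j) ^ (\<gamma> j))"
    for x :: "real^'n" and \<gamma>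
    by (rule prod.remove) auto
  have "pd i (\<lambda>x::real^'n. c * (\<Prod>j\<in>UNIV. (x $ j) ^ (\<alpha> j))) x =
      (c * \<alpha> i) * (\<Prod>j\<in>UNIV. (x $ j) ^ (?\<beta> j))" for x
  proof (rule pd_eqI)
    have "(\<Prod>j\<in>UNIV. ((x + t *\<^sub>R axis i 1) $ j) ^ (\<alpha> j)) = (x $ i + t) ^ \<alpha> i * ?R x" for t
      unfolding split by (auto simp: axis_def intro!: prod.cong)
    moreover have "(\<Prod>j\<in>UNIV. (x $ j) ^ (?\<beta> j)) = (x $ i) ^ (\<alpha> i - 1) * ?R x"
      unfolding split by (auto intro!: prod.cong)
    moreover have "((\<lambda>t. c * ((x $ i + t) ^ \<alpha> i * ?R x)) has_real_derivative
        (c * \<alpha> i) * ((x $ i) ^ (\<alpha> i - 1) * ?R x)) (at 0)"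
      by (auto intro!: derivative_eq_intros)
    ultimately show "((\<lambda>t. c * (\<Prod>j\<in>UNIV. ((x + t *\<^sub>R axis i 1) $ j) ^ (\<alpha> j)))
        has_real_derivative (c * \<alpha> i) * (\<Prod>j\<in>UNIV. (x $ j) ^ (?\<beta> j))) (at 0)"
      by (simp only:)
  qed
  \<comment> \<open>If \<open>\<alpha> i = 0\<close>, the exponent is truncated but the coefficient
    \<open>c * \<alpha> i\<close> vanishes, and the zero polynomial is homogeneous of every degree.
    This also covers \<open>k = 0\<close>.\<close>
  moreover have "hom_poly (k - 1) (\<lambda>x::real^'n. (c * \<alpha> i) * (\<Prod>j\<in>UNIV. (x $ j) ^ (?\<beta> j)))"
  proof (cases "\<alpha> i = 0")
    case False
    have "sum \<alpha> UNIV = \<alpha> i + sum \<alpha> (UNIV - {i})" "sum ?\<beta> UNIV = ?\<beta> i + sum ?\<beta> (UNIV - {i})"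
      by (rule sum.remove; simp)+
    moreover have "sum ?\<beta> (UNIV - {i}) = sum \<alpha> (UNIV - {i})" by (rule sum.cong) auto
    ultimately have "sum ?\<beta> UNIV = k - 1" using False monomial by simp
    then show ?thesis by (rule hom_poly_monomial)
  qed (simp add: hom_poly_zero)
  ultimately show ?case by presburger
qed (simp_all add: hom_poly_zero hom_poly_add pd_add real_polynomial_function_hom_poly)

lemma hom_poly_scaleR:
  fixes p :: "real^'n \<Rightarrow> real"
  assumes "hom_poly k p"
  shows "p (t *\<^sub>R x) = t ^ k * p x"
  using assms
  by (induction rule: hom_poly_induct)
    (auto simp: power_mult_distrib prod.distrib power_sum distrib_left)

lemma hom_poly_0_const:
  fixes p :: "real^'n \<Rightarrow> real"
  assumes "hom_poly 0 p"
  shows "pd i p = (\<lambda>x. 0)"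
proof -
  have "p = (\<lambda>x. p 0)" using hom_poly_scaleR[OF assms, of 0] by (intro ext) (metis power_0 mult_1 scaleR_zero_left)
  then show ?thesis by (metis pd_const)
qed

text \<open>Differentiate \<open>p ((1 + t) x) = (1 + t)^k p x\<close> at \<open>t = 0\<close> in
  two ways.\<close>

lemma hom_poly_euler:
  fixes p :: "real^'n \<Rightarrow> real"
  assumes "hom_poly k p"
  shows "(\<Sum>i\<in>UNIV. x $ i * pd i p x) = k * p x"
proof -
  have "p (x + t *\<^sub>R x) = (1 + t) ^ k * p x" for t
    using hom_poly_scaleR[OF assms, of "1 + t" x] by (simp add: scaleR_left_distrib)
  then have "((\<lambda>t. (1 + t) ^ k * p x) has_real_derivative (\<Sum>i\<in>UNIV. x $ i * pd i p x)) (at 0)"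
    using has_derivative_imp_line_derivative[OF has_derivative_pd, OF real_polynomial_function_hom_poly,
        OF assms, of x x] by simp
  moreover have "((\<lambda>t. (1 + t) ^ k * p x) has_real_derivative k * p x) (at 0)"
    by (auto intro!: derivative_eq_intros)
  ultimately show ?thesis by (rule DERIV_unique)
qed

section \<open>Sphere integrals as ball integrals\<close>

lemma lborel_integral_scaleR:
  fixes f :: "real^'n \<Rightarrow> real"
  assumes [measurable]: "f \<in> borel_measurable borel" and "c > 0"
  shows "(LINT x|lborel. f x) = c ^ CARD('n) * (LINT x|lborel. f (c *\<^sub>R x))"
proof -
  have "(LINT x|lborel. f x) =
      (LINT x|density (distr lborel borel (\<lambda>x::real^'n. 0 + c *\<^sub>R x)) (\<lambda>_. \<bar>c\<bar> ^ DIM(real^'n)). f x)"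
    using lborel_affine[of c "0::real^'n"] \<open>c > 0\<close> by (metis less_irrefl)
  also have "\<dots> = c ^ CARD('n) * (LINT x|lborel. f (c *\<^sub>R x))"
    using \<open>c > 0\<close> by (subst integral_density) (simp_all add: integral_distr)
  finally show ?thesis .
qed

text \<open>The substitution \<open>x = r y\<close> contributes \<open>r^n\<close>, the homogeneity
  \<open>r^d\<close>. Only the behaviour under this one factor \<open>r\<close> is assumed, so
  radial projections are covered with \<open>d = 0\<close> as well as polynomials.\<close>

lemma lborel_integral_ball_homogeneous:
  fixes f :: "real^'n \<Rightarrow> real"
  assumes [measurable]: "f \<in> borel_measurable borel" and "r > 0"
    and hom: "\<And>x. f (r *\<^sub>R x) = r ^ d * f x"
  shows "(LINT x|lborel. indicator (ball 0 r) x * f x) =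
    r ^ (CARD('n) + d) * (LINT x|lborel. indicator (ball 0 1) x * f x)"
proof -
  have "(LINT x|lborel. indicator (ball 0 r) x * f x) =
      r ^ CARD('n) * (LINT x|lborel. indicator (ball 0 r) (r *\<^sub>R x) * f (r *\<^sub>R x))"
    using \<open>r > 0\<close>
    by (intro lborel_integral_scaleR borel_measurable_times borel_measurable_indicator) auto
  also have "(\<lambda>x. indicator (ball 0 r) (r *\<^sub>R x) * f (r *\<^sub>R x)) =
      (\<lambda>x. r ^ d * (indicator (ball 0 1) x * f x))"
    using \<open>r > 0\<close> by (auto simp: hom indicator_def)
  finally show ?thesis by (simp add: power_add)
qed

lemma real_polynomial_function_bounded_cball:
  fixes p :: "'a::euclidean_space \<Rightarrow> real"
  assumes "real_polynomial_function p"
  obtains C where "C \<ge> 0" "\<And>x. norm x \<le> r \<Longrightarrow> \<bar>p x\<bar> \<le> C"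
proof -
  have "compact (p ` cball 0 r)"
    using assms by (intro compact_continuous_image continuous_on_polymonial_function)
      (auto simp: real_polynomial_function_eq)
  then obtain B where "\<forall>y\<in>p ` cball 0 r. norm y \<le> B"
    using compact_imp_bounded bounded_iff by blast
  then show ?thesis by (intro that[of "max B 0"]) (auto simp: le_max_iff_disj)
qed

lemma borel_measurable_real_polynomial_function:
  fixes p :: "'a::euclidean_space \<Rightarrow> real"
  assumes "real_polynomial_function p"
  shows "p \<in> borel_measurable borel"
  using assms by (intro borel_measurable_continuous_onI continuous_on_polymonial_function)
      (auto simp: real_polynomial_function_eq)

lemma integrable_indicator_bounded:
  fixes f :: "'a::euclidean_space \<Rightarrow> real"
  assumes "f \<in> borel_measurable borel" "\<And>x. norm x < r \<Longrightarrow> \<bar>f x\<bar> \<le> C" "A \<in> sets borel" "A \<subseteq> ball 0 r"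
  shows "integrable lborel (\<lambda>x. indicator A x * f x)"
proof -
  have "emeasure lborel A \<le> emeasure lborel (ball (0::'a) r)"
    using assms by (intro emeasure_mono) auto
  also have "\<dots> < \<infinity>" using emeasure_bounded_finite[OF bounded_ball] by simp
  finally have "emeasure lborel A < \<infinity>" .
  moreover have "AE x in lborel. x \<in> A \<longrightarrow> norm (f x) \<le> C"
    using assms by (intro AE_I2) auto
  ultimately have "integrable lborel (\<lambda>x. indicator A x *\<^sub>R f x)"
    using assms by (intro integrableI_bounded_set_indicator) auto
  then show ?thesis by simp
qed

lemma borel_measurable_radial_projection:
  fixes p :: "'a::euclidean_space \<Rightarrow> real"
  assumes "real_polynomial_function p"
  shows "(\<lambda>x. p (x /\<^sub>R norm x)) \<in> borel_measurable borel"
proof -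
  note borel_measurable_real_polynomial_function[OF assms, measurable]
  show ?thesis by measurable
qed

lemma norm_radial_projection_le: "norm (x /\<^sub>R norm x) \<le> 1"
  by (cases "x = 0") auto

lemma integrable_radial_projection:
  fixes p :: "'a::euclidean_space \<Rightarrow> real"
  assumes "real_polynomial_function p"
  shows "integrable lborel (\<lambda>x. indicator (ball 0 1) x * p (x /\<^sub>R norm x))"
proof -
  obtain C where "C \<ge> 0" "\<And>x. norm x \<le> 1 \<Longrightarrow> \<bar>p x\<bar> \<le> C"
    using real_polynomial_function_bounded_cball[OF assms, of 1] by metis
  then show ?thesis
    by (intro integrable_indicator_bounded[where r = 1 and C = C] borel_measurable_radial_projection
        assms) (auto intro: norm_radial_projection_le)
qed

lemma
  fixes p :: "real^'n \<Rightarrow> real"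
  assumes "real_polynomial_function p"
  shows integrable_on_radial_projection: "(\<lambda>x. p (x /\<^sub>R norm x)) integrable_on ball 0 1"
    and sph_int_lborel: "sph_int p = CARD('n) * (LINT x|lborel. indicator (ball 0 1) x * p (x /\<^sub>R norm x))"
proof -
  have "set_integrable lborel (ball 0 1) (\<lambda>x. p (x /\<^sub>R norm x))"
    using integrable_radial_projection[OF assms] by (simp add: set_integrable_def)
  from set_borel_integral_eq_integral[OF this]
  show "(\<lambda>x. p (x /\<^sub>R norm x)) integrable_on ball 0 1"
    and "sph_int p = CARD('n) * (LINT x|lborel. indicator (ball 0 1) x * p (x /\<^sub>R norm x))"
    by (simp_all add: sph_int_def set_lebesgue_integral_def)
qed

text \<open>On the thin shell \<open>r \<le> |x| < 1\<close> the integrals of \<open>h(x)\<close> and \<open>h(x/|x|)\<close> differ by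
  \<open>O((1 - r)\<^sup>2)\<close>, while scaling evaluates them as \<open>(1 - r\<^bsup>n+d\<^esup>) J\<close> and \<open>(1 - r\<^sup>n) I\<close>; divide by
  \<open>1 - r\<close> and let \<open>r \<rightarrow> 1\<close>.\<close>

lemma sph_int_hom_poly:
  fixes h :: "real^'n \<Rightarrow> real"
  assumes h: "hom_poly d h"
  shows "sph_int h = (CARD('n) + d) * (LINT x|lborel. indicator (ball 0 1) x * h x)"
proof -
  define n where "n = CARD('n)"
  define K where "K x = h (x /\<^sub>R norm x)" for x
  define J where "J = (LINT x|lborel. indicator (ball 0 1) x * h x)"
  define I where "I = (LINT x|lborel. indicator (ball 0 1) x * K x)"
  define V where "V = (LINT x|lborel. indicator (ball (0::real^'n) 1) x * (1::real))"
  note rpf = real_polynomial_function_hom_poly[OF h]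
  obtain C where C: "C \<ge> 0" "\<And>x. norm x \<le> 1 \<Longrightarrow> \<bar>h x\<bar> \<le> C"
    using real_polynomial_function_bounded_cball[OF rpf, of 1] by metis
  have hm[measurable]: "h \<in> borel_measurable borel"
    by (rule borel_measurable_real_polynomial_function[OF rpf])
  have Km[measurable]: "K \<in> borel_measurable borel"
    unfolding K_def by (rule borel_measurable_radial_projection[OF rpf])
  have KC: "\<bar>K x\<bar> \<le> C" for x
    unfolding K_def by (rule C(2)) (rule norm_radial_projection_le)
  have hK: "h x = norm x ^ d * K x" if "x \<noteq> 0" for x
    using hom_poly_scaleR[OF h, of "norm x" "x /\<^sub>R norm x"] that by (simp add: K_def)
  have shell: "\<bar>(1 - r ^ (n + d)) * J - (1 - r ^ n) * I\<bar> \<le> C * (1 - r ^ d) * ((1 - r ^ n) * V)"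
    if r: "0 < r" "r < 1" for r
  proof -
    define S where "S = ball (0::real^'n) 1 - ball 0 r"
    have int: "integrable lborel (\<lambda>x. indicator A x * f x)"
      if "A \<in> {ball 0 1, ball 0 r, S}" "f \<in> {h, K, \<lambda>x. 1}" for A :: "(real^'n) set" and f
      using that r C KC unfolding S_def
      by (intro integrable_indicator_bounded[where r = 1 and C = "max C 1"]) (auto simp: le_max_iff_disj)
    have diff: "(LINT x|lborel. indicator S x * f x) =
        (LINT x|lborel. indicator (ball 0 1) x * f x) - (LINT x|lborel. indicator (ball 0 r) x * f x)"
      if "f \<in> {h, K, \<lambda>x. 1}" for f
    proof -
      have "(\<lambda>x. indicator S x * f x) = (\<lambda>x. indicator (ball 0 1) x * f x - indicator (ball 0 r) x * f x)"
        using r by (auto simp: S_def indicator_def fun_eq_iff)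
      then show ?thesis using int that by simp
    qed
    have Jr: "(LINT x|lborel. indicator S x * h x) = (1 - r ^ (n + d)) * J"
      using diff[of h] lborel_integral_ball_homogeneous[OF hm \<open>0 < r\<close> hom_poly_scaleR[OF h]]
      by (simp add: J_def n_def algebra_simps)
    have eq: "inverse r * inverse (norm x) * r = inverse (norm x)" for x :: "real^'n"
      using \<open>0 < r\<close> by (cases "x = 0") (simp_all add: field_simps)
    \<comment> \<open>The projected function is constant along rays, hence of degree 0.\<close>
    have "K (r *\<^sub>R x) = r ^ 0 * K x" for x using \<open>0 < r\<close> by (simp add: K_def eq)
    from lborel_integral_ball_homogeneous[OF Km \<open>0 < r\<close> this]
    have Ir: "(LINT x|lborel. indicator S x * K x) = (1 - r ^ n) * I"
      using diff[of K] by (simp add: I_def n_def algebra_simps)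
    have Vr: "(LINT x|lborel. indicator S x * 1) = (1 - r ^ n) * V"
      using diff[of "\<lambda>x. 1"] lborel_integral_ball_homogeneous[OF _ \<open>0 < r\<close>, of "\<lambda>x::real^'n. 1" 0]
      by (simp add: V_def n_def algebra_simps)
    have "\<bar>(1 - r ^ (n + d)) * J - (1 - r ^ n) * I\<bar> =
        \<bar>LINT x|lborel. indicator S x * h x - indicator S x * K x\<bar>"
      using int by (simp add: Jr Ir)
    also have "\<dots> \<le> (LINT x|lborel. C * (1 - r ^ d) * (indicator S x * 1))"
    proof (rule Bochner_Integration.integral_abs_bound_integral)
      fix x :: "real^'n"
      show "\<bar>indicator S x * h x - indicator S x * K x\<bar> \<le> C * (1 - r ^ d) * (indicator S x * 1)"
      proof (cases "x \<in> S")
        case True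
        then have x: "x \<noteq> 0" "r \<le> norm x" "norm x \<le> 1" using r by (auto simp: S_def)
        have "\<bar>h x - K x\<bar> = \<bar>K x * (norm x ^ d - 1)\<bar>"
          using hK[OF x(1)] by (simp add: algebra_simps)
        also have "\<dots> \<le> C * (1 - r ^ d)"
          unfolding abs_mult using x r KC C(1) power_mono[OF x(2), of d] power_le_one[of "norm x" d]
          by (intro mult_mono) auto
        finally show ?thesis using True by simp
      qed simp
    qed (use int int[of S "\<lambda>x. 1"] in auto)
    also have "\<dots> = C * (1 - r ^ d) * ((1 - r ^ n) * V)" using Vr by simp
    finally show ?thesis .
  qed
  \<comment> \<open>The geometric sum is \<open>(1 - r^m) / (1 - r)\<close>. It extends continuously
    to \<open>r = 1\<close> with value \<open>m\<close>, so the limit is taken after the factor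
    \<open>1 - r\<close> has been cancelled; the error bound then tends to 0 because of
    \<open>1 - r^d\<close>.\<close>
  define g where "g m r = (\<Sum>i<m. r ^ i)" for m and r :: real
  have "\<bar>g (n + d) r * J - g n r * I\<bar> \<le> C * (1 - r ^ d) * (g n r * V)" if r: "0 < r" "r < 1" for r
  proof -
    have *: "1 - r ^ m = (1 - r) * g m r" for m by (simp add: g_def one_diff_power_eq)
    have "(1 - r) * \<bar>g (n + d) r * J - g n r * I\<bar> = \<bar>(1 - r ^ (n + d)) * J - (1 - r ^ n) * I\<bar>"
      unfolding * by (simp only: mult.assoc abs_mult flip: right_diff_distrib) (use r in simp)
    also have "\<dots> \<le> (1 - r) * (C * (1 - r ^ d) * (g n r * V))"
      using shell[OF r] unfolding *[of n] by (simp add: mult_ac)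
    finally show ?thesis using r by simp
  qed
  then have "\<forall>\<^sub>F r in at_left 1. \<bar>g (n + d) r * J - g n r * I\<bar> \<le> C * (1 - r ^ d) * (g n r * V)"
    unfolding eventually_at_left_field by (intro exI[of _ 0]) auto
  moreover have "((\<lambda>r. \<bar>g (n + d) r * J - g n r * I\<bar>) \<longlongrightarrow> \<bar>g (n + d) 1 * J - g n 1 * I\<bar>) (at_left 1)"
    "((\<lambda>r. C * (1 - r ^ d) * (g n r * V)) \<longlongrightarrow> C * (1 - 1 ^ d) * (g n 1 * V)) (at_left 1)"
    unfolding g_def by (intro tendsto_intros)+
  ultimately have "\<bar>g (n + d) 1 * J - g n 1 * I\<bar> \<le> C * (1 - 1 ^ d) * (g n 1 * V)"
    by (intro tendsto_le[OF trivial_limit_at_left_real]) auto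
  then have "n * I = (n + d) * J" by (simp add: g_def)
  then show ?thesis
    using sph_int_lborel[OF rpf] by (simp add: n_def I_def J_def K_def)
qed

section \<open>Integration by parts on the sphere\<close>

lemma lborel_integral_translate:
  fixes f :: "'a::euclidean_space \<Rightarrow> real"
  assumes [measurable]: "f \<in> borel_measurable borel"
  shows "(LINT x|lborel. f (x + a)) = (LINT x|lborel. f x)"
proof -
  have "(LINT x|lborel. f x) = (LINT x|distr lborel borel ((+) a). f x)"
    by (simp add: lborel_distr_plus)
  also have "\<dots> = (LINT x|lborel. f (a + x))"
    by (simp add: integral_distr)
  finally show ?thesis by (simp add: add.commute)
qed

text \<open>By translation invariance every difference quotient of \<open>\<phi>\<close> along
  \<open>e\<close> has integral zero. The quotients converge to \<open>\<psi>\<close>, the mean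
  value theorem bounds them by \<open>D\<close>, and they vanish outside a fixed ball, so dominated
  convergence applies.\<close>

lemma lborel_integral_line_derivative_eq_0:
  fixes \<phi> \<psi> :: "'a::euclidean_space \<Rightarrow> real"
  assumes \<phi>m: "\<phi> \<in> borel_measurable borel" and \<psi>m: "\<psi> \<in> borel_measurable borel"
    and deriv: "\<And>x t. ((\<lambda>t. \<phi> (x + t *\<^sub>R e)) has_real_derivative \<psi> (x + t *\<^sub>R e)) (at t)"
    and supp: "\<And>x. norm x \<ge> 1 \<Longrightarrow> \<phi> x = 0"
    and \<phi>_le: "\<And>x. \<bar>\<phi> x\<bar> \<le> B" and \<psi>_le: "\<And>x. \<bar>\<psi> x\<bar> \<le> D"
    and e: "norm e = 1"
  shows "(LINT x|lborel. \<psi> x) = 0"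
proof -
  define s where "s m x = (\<phi> (x + (1 / real (Suc m)) *\<^sub>R e) - \<phi> x) * real (Suc m)" for m x
  have \<phi>tm: "(\<lambda>x. \<phi> (x + a)) \<in> borel_measurable borel" for a
  proof -
    note \<phi>m[measurable]
    show ?thesis by measurable
  qed
  have \<phi>i: "integrable lborel (\<lambda>x. \<phi> (x + a))" if "norm a \<le> 1" for a
  proof -
    have "\<phi> (x + a) = 0" if "norm x \<ge> 2" for x
      using that \<open>norm a \<le> 1\<close> norm_diff_ineq[of x a] by (intro supp) linarith
    then have "(\<lambda>x. indicator (ball 0 2) x * \<phi> (x + a)) = (\<lambda>x. \<phi> (x + a))"
      by (auto simp: indicator_def fun_eq_iff)
    moreover have "integrable lborel (\<lambda>x. indicator (ball 0 2) x * \<phi> (x + a))"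
      using \<phi>tm \<phi>_le by (intro integrable_indicator_bounded[where r = 2 and C = B]) auto
    ultimately show ?thesis by simp
  qed
  have norm_step: "norm ((1 / real (Suc m)) *\<^sub>R e) \<le> 1" for m
    using e by simp
  have s_int: "(LINT x|lborel. s m x) = 0" for m
    using \<phi>i[OF norm_step, of m] \<phi>i[of 0] lborel_integral_translate[OF \<phi>m]
    unfolding s_def by simp
  \<comment> \<open>The steps have length at most 1, so for \<open>norm x \<ge> 3\<close> both
    arguments of \<open>\<phi>\<close> lie outside its support.\<close>
  have s_le: "\<bar>s m x\<bar> \<le> indicator (ball 0 3) x * D" for m x
  proof (cases "norm x < 3")
    case True
    obtain z where "\<phi> (x + (1 / real (Suc m)) *\<^sub>R e) - \<phi> (x + 0 *\<^sub>R e) =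
        (1 / real (Suc m) - 0) * \<psi> (x + z *\<^sub>R e)"
      using MVT2[of 0 "1 / real (Suc m)" "\<lambda>t. \<phi> (x + t *\<^sub>R e)" "\<lambda>t. \<psi> (x + t *\<^sub>R e)"] deriv by auto
    then have "s m x = \<psi> (x + z *\<^sub>R e)" by (simp add: s_def)
    then show ?thesis using \<psi>_le True by simp
  next
    case False
    then have "norm (x + (1 / real (Suc m)) *\<^sub>R e) \<ge> 1"
      using norm_diff_ineq[of x "(1 / real (Suc m)) *\<^sub>R e"] norm_step[of m] by linarith
    then show ?thesis using False supp by (simp add: s_def)
  qed
  have "(\<lambda>m. s m x) \<longlonglongrightarrow> \<psi> x" for x
  proof -
    have "(\<lambda>t. (\<phi> (x + t *\<^sub>R e) - \<phi> x) / t) \<midarrow>0\<rightarrow> \<psi> x"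
      using deriv[of x 0] by (simp add: DERIV_def)
    moreover have "filterlim (\<lambda>m. 1 / real (Suc m)) (at 0) sequentially"
      unfolding filterlim_at using LIMSEQ_inverse_real_of_nat by (simp add: divide_inverse)
    ultimately have "(\<lambda>m. (\<phi> (x + (1 / real (Suc m)) *\<^sub>R e) - \<phi> x) / (1 / real (Suc m))) \<longlonglongrightarrow> \<psi> x"
      by (rule filterlim_compose)
    then show ?thesis by (simp add: s_def)
  qed
  moreover have "integrable lborel (\<lambda>x::'a. indicator (ball 0 3) x * D)"
    by (intro integrable_indicator_bounded[where r = 3 and C = "\<bar>D\<bar>"]) auto
  ultimately have "(\<lambda>m. LINT x|lborel. s m x) \<longlonglongrightarrow> (LINT x|lborel. \<psi> x)"
    using \<psi>m \<phi>m \<phi>tm s_le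
    by (intro integral_dominated_convergence[where w = "\<lambda>x. indicator (ball 0 3) x * D"])
      (auto simp: s_def[abs_def])
  then show ?thesis unfolding s_int by (simp add: LIMSEQ_const_iff)
qed

text \<open>Squaring makes the truncation differentiable at its kink: at \<open>u = 0\<close> the
  difference quotient is at most \<open>\<bar>h\<bar>\<close> in absolute value. This is why the
  cutoff carries the power 2.\<close>

lemma has_real_derivative_max_0_square:
  "((\<lambda>u::real. (max 0 u)\<^sup>2) has_real_derivative 2 * max 0 u) (at u)"
proof -
  consider "u > 0" | "u < 0" | "u = 0" by linarith
  then show ?thesis
  proof cases
    case 1
    have "((\<lambda>u::real. u\<^sup>2) has_real_derivative 2 * max 0 u) (at u)"
      using 1 by (auto intro!: derivative_eq_intros)
    then show ?thesis
      by (rule has_field_derivative_transform_within_open[of _ _ _ "{0<..}"]) (use 1 in auto)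
  next
    case 2
    have "((\<lambda>u::real. 0) has_real_derivative 2 * max 0 u) (at u)"
      using 2 by (auto intro!: derivative_eq_intros)
    then show ?thesis
      by (rule has_field_derivative_transform_within_open[of _ _ _ "{..<0}"]) (use 2 in auto)
  next
    case 3
    have "((\<lambda>h::real. (max 0 h)\<^sup>2 / h) \<longlongrightarrow> 0) (at 0)"
    proof (rule Lim_null_comparison)
      show "\<forall>\<^sub>F h::real in at 0. norm ((max 0 h)\<^sup>2 / h) \<le> \<bar>h\<bar>"
        by (rule always_eventually) (auto simp: max_def power2_eq_square)
      show "((\<lambda>h::real. \<bar>h\<bar>) \<longlongrightarrow> 0) (at 0)"
        by (rule tendsto_eq_intros refl | simp)+
    qed
    then show ?thesis using 3 by (simp add: DERIV_def)
  qed
qed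

lemma pd_norm_square: "pd i (\<lambda>x::real^'n. (norm x)\<^sup>2) = (\<lambda>x. 2 * x $ i)"
proof -
  have "(\<lambda>x::real^'n. (norm x)\<^sup>2) = (\<lambda>x. \<Sum>j\<in>UNIV. x $ j * x $ j)"
    by (simp add: norm_vec_def L2_set_def power2_eq_square sum_nonneg)
  then show ?thesis
    by (simp add: pd_sum pd_mult pd_component rpf_intros if_distrib if_distribR sum.distrib
        cong: if_cong)
qed

text \<open>With \<open>u = 1 - |x|^2\<close>, the product of the squared positive part of
  \<open>u\<close> and \<open>h\<close> is differentiable everywhere and vanishes off the ball. Its
  partial derivative \<open>u^2 pd i h - 4 u x_i h\<close> on the ball, and 0 outside, therefore has
  integral zero.\<close>

lemma lborel_integral_ball_pd:
  fixes h :: "real^'n \<Rightarrow> real"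
  assumes "real_polynomial_function h"
  shows "(LINT x|lborel. indicator (ball 0 1) x * ((1 - (norm x)\<^sup>2)\<^sup>2 * pd i h x)) =
    (LINT x|lborel. indicator (ball 0 1) x * (4 * (1 - (norm x)\<^sup>2) * (x $ i * h x)))"
proof -
  let ?B = "ball (0::real^'n) 1"
  define u where "u x = 1 - (norm x)\<^sup>2" for x :: "real^'n"
  define \<phi> where "\<phi> x = (max 0 (u x))\<^sup>2 * h x" for x
  define f where "f x = (u x)\<^sup>2 * pd i h x" for x
  define g where "g x = 4 * u x * (x $ i * h x)" for x
  define \<psi> where "\<psi> x = indicator ?B x * f x - indicator ?B x * g x" for x
  have n2: "real_polynomial_function (\<lambda>x::real^'n. (norm x)\<^sup>2)"
    by (rule real_polynomial_function_hom_poly[OF hom_poly_norm_square])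
  then have u: "real_polynomial_function u"
    unfolding u_def by (intro real_polynomial_function_diff real_polynomial_function.intros(2))
  have f: "real_polynomial_function f" and g: "real_polynomial_function g"
    unfolding f_def g_def using assms u by (intro rpf_intros real_polynomial_function_pd; simp)+
  note [measurable] = borel_measurable_real_polynomial_function[OF u]
    borel_measurable_real_polynomial_function[OF assms]
    borel_measurable_real_polynomial_function[OF f] borel_measurable_real_polynomial_function[OF g]
  have u_iff: "u x > 0 \<longleftrightarrow> x \<in> ?B" for x
    by (simp add: u_def power_less_one_iff abs_square_less_1)
  obtain Cf where Cf: "Cf \<ge> 0" "\<And>x. norm x \<le> 1 \<Longrightarrow> \<bar>f x\<bar> \<le> Cf"
    using real_polynomial_function_bounded_cball[OF f, of 1] by metis
  obtain Cg where Cg: "Cg \<ge> 0" "\<And>x. norm x \<le> 1 \<Longrightarrow> \<bar>g x\<bar> \<le> Cg"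
    using real_polynomial_function_bounded_cball[OF g, of 1] by metis
  obtain Ch where Ch: "Ch \<ge> 0" "\<And>x. norm x \<le> 1 \<Longrightarrow> \<bar>h x\<bar> \<le> Ch"
    using real_polynomial_function_bounded_cball[OF assms, of 1] by metis
  have int: "integrable lborel (\<lambda>x. indicator ?B x * f x)" "integrable lborel (\<lambda>x. indicator ?B x * g x)"
    using integrable_indicator_bounded[where f = f and r = 1 and C = Cf and A = ?B] Cf
      integrable_indicator_bounded[where f = g and r = 1 and C = Cg and A = ?B] Cg by simp_all
  have "(LINT x|lborel. \<psi> x) = 0"
  proof (rule lborel_integral_line_derivative_eq_0)
    show "\<phi> \<in> borel_measurable borel"
      unfolding \<phi>_def by measurable
    show "\<psi> \<in> borel_measurable borel"
      unfolding \<psi>_def by (intro borel_measurable_diff borel_measurable_times borel_measurable_indicator) auto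
    show "((\<lambda>t. \<phi> (x + t *\<^sub>R axis i 1)) has_real_derivative \<psi> (x + t *\<^sub>R axis i 1)) (at t)" for x t
    proof -
      let ?y = "x + t *\<^sub>R axis i 1"
      have "pd i u = (\<lambda>x. - (2 * x $ i))"
        unfolding u_def pd_diff[OF real_polynomial_function.intros(2) n2] by (simp add: pd_norm_square)
      then have "((\<lambda>t. (max 0 (u (x + t *\<^sub>R axis i 1)))\<^sup>2) has_real_derivative
          2 * max 0 (u ?y) * (- (2 * ?y $ i))) (at t)"
        using DERIV_chain2[OF has_real_derivative_max_0_square differentiable_has_real_derivative_pd[OF
          differentiable_at_real_polynomial_function[OF u], of x i t]]
        by simp
      from DERIV_mult[OF this differentiable_has_real_derivative_pd[OF
          differentiable_at_real_polynomial_function[OF assms], of x i t]]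
      have "((\<lambda>t. \<phi> (x + t *\<^sub>R axis i 1)) has_real_derivative
          (max 0 (u ?y))\<^sup>2 * pd i h ?y - 4 * max 0 (u ?y) * (?y $ i * h ?y)) (at t)"
        unfolding \<phi>_def by (rule DERIV_cong) (simp add: algebra_simps)
      also have "(max 0 (u ?y))\<^sup>2 * pd i h ?y - 4 * max 0 (u ?y) * (?y $ i * h ?y) = \<psi> ?y"
        using u_iff[of ?y] by (cases "?y \<in> ?B") (simp_all add: \<psi>_def f_def g_def)
      finally show ?thesis .
    qed
    show "\<phi> x = 0" if "norm x \<ge> 1" for x
      using u_iff[of x] that by (simp add: \<phi>_def)
    show "\<bar>\<phi> x\<bar> \<le> Ch" for x
    proof (cases "x \<in> ?B")
      case True
      then have "0 < u x" "u x \<le> 1" using u_iff by (auto simp: u_def)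
      then have "\<bar>(u x)\<^sup>2\<bar> * \<bar>h x\<bar> \<le> 1 * Ch"
        using True Ch by (intro mult_mono) (auto simp: power_le_one)
      then show ?thesis using \<open>0 < u x\<close> by (simp add: \<phi>_def abs_mult)
    qed (use u_iff[of x] Ch in \<open>simp add: \<phi>_def\<close>)
    show "\<bar>\<psi> x\<bar> \<le> Cf + Cg" for x
      using Cf(1) Cf(2)[of x] Cg(1) Cg(2)[of x] by (cases "x \<in> ?B") (auto simp: \<psi>_def)
  qed simp
  then show ?thesis
    using int unfolding \<psi>_def f_def g_def u_def by simp
qed

section \<open>Rules for sphere integrals, weighted ball integrals and integration by parts\<close>

lemma sph_int_cong:
  fixes f g :: "real^'n \<Rightarrow> 'b::euclidean_space"
  assumes "\<And>x. x \<in> sphere 0 1 \<Longrightarrow> f x = g x"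
  shows "sph_int f = sph_int g"
proof -
  \<comment> \<open>The radial projection lands on the sphere except at the origin, which is a null
    set.\<close>
  have "integral (ball 0 1) (\<lambda>x. f (x /\<^sub>R norm x)) = integral (ball 0 1) (\<lambda>x. g (x /\<^sub>R norm x))"
    by (rule integral_spike[of "{0}"]) (auto intro!: assms[symmetric])
  then show ?thesis by (simp add: sph_int_def)
qed

lemma sph_int_0 [simp]: "sph_int (\<lambda>x::real^'n. 0) = 0"
  by (simp add: sph_int_def)

lemma sph_int_add:
  fixes p q :: "real^'n \<Rightarrow> real"
  assumes "real_polynomial_function p" "real_polynomial_function q"
  shows "sph_int (\<lambda>x. p x + q x) = sph_int p + sph_int q"
  using integral_add[OF assms[THEN integrable_on_radial_projection]]
  by (simp add: sph_int_def algebra_simps)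

lemma sph_int_diff:
  fixes p q :: "real^'n \<Rightarrow> real"
  assumes "real_polynomial_function p" "real_polynomial_function q"
  shows "sph_int (\<lambda>x. p x - q x) = sph_int p - sph_int q"
  using integral_diff[OF assms[THEN integrable_on_radial_projection]]
  by (simp add: sph_int_def right_diff_distrib)

lemma sph_int_cmult:
  fixes p :: "real^'n \<Rightarrow> real"
  shows "sph_int (\<lambda>x. c * p x) = c * sph_int p"
  by (simp add: sph_int_def)

lemma sph_int_sum:
  fixes p :: "'a \<Rightarrow> real^'n \<Rightarrow> real"
  assumes "finite I" "\<And>j. j \<in> I \<Longrightarrow> real_polynomial_function (p j)"
  shows "sph_int (\<lambda>x. \<Sum>j\<in>I. p j x) = (\<Sum>j\<in>I. sph_int (p j))"
  using assms by (induction I) (simp_all add: sph_int_add rpf_intros)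

text \<open>The weight equals 1 on the sphere but raises the degree by \<open>2 * m\<close>, so
  \<open>sph_int_hom_poly\<close> gives the same sphere integral with a larger denominator.\<close>

lemma lborel_integral_ball_norm_power:
  fixes g :: "real^'n \<Rightarrow> real"
  assumes "hom_poly d g"
  shows "(LINT x|lborel. indicator (ball 0 1) x * (((norm x)\<^sup>2) ^ m * g x)) =
    sph_int g / (CARD('n) + d + 2 * m)"
proof -
  have "hom_poly (2 * m) (\<lambda>x::real^'n. ((norm x)\<^sup>2) ^ m)"
  proof (induction m)
    case (Suc m)
    then show ?case using hom_poly_mult[OF hom_poly_norm_square Suc] by simp
  qed (simp add: hom_poly_const)
  then have "hom_poly (2 * m + d) (\<lambda>x. ((norm x)\<^sup>2) ^ m * g x)"
    using assms by (rule hom_poly_mult)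
  from sph_int_hom_poly[OF this] sph_int_cong[of "\<lambda>x. ((norm x)\<^sup>2) ^ m * g x" g]
  have eq: "sph_int g = (CARD('n) + d + 2 * m) *
      (LINT x|lborel. indicator (ball 0 1) x * (((norm x)\<^sup>2) ^ m * g x))"
    by (simp add: add_ac)
  have "real (CARD('n) + d + 2 * m) \<noteq> 0" unfolding of_nat_eq_0_iff by simp
  then show ?thesis unfolding eq by (rule nonzero_mult_div_cancel_left[symmetric])
qed

text \<open>Expand the weights in \<open>lborel_integral_ball_pd\<close> into powers of
  \<open>|x|^2\<close> and convert each term to a sphere integral. The derivative has degree
  \<open>d\<close> and gives the denominators \<open>N\<close>, \<open>N + 2\<close>,
  \<open>N + 4\<close>; the product with the coordinate has degree \<open>d + 2\<close> and gives
  \<open>N + 2\<close>, \<open>N + 4\<close>.\<close>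

lemma sph_int_pd:
  fixes h :: "real^'n \<Rightarrow> real"
  assumes h: "hom_poly (Suc d) h"
  shows "sph_int (pd i h) = (CARD('n) + d) * sph_int (\<lambda>x. x $ i * h x)"
proof -
  let ?I = "\<lambda>f. (LINT x|lborel. indicator (ball (0::real^'n) 1) x * f x)"
  define N where "N = real CARD('n) + d"
  have N: "N > 0" by (simp add: N_def add_pos_nonneg)
  have p: "hom_poly d (pd i h)" using hom_poly_pd[OF h] by simp
  have q: "hom_poly (Suc (Suc d)) (\<lambda>x. x $ i * h x)"
    using hom_poly_mult[OF hom_poly_component h] by simp
  have int: "integrable lborel (\<lambda>x. indicator (ball (0::real^'n) 1) x * (((norm x)\<^sup>2) ^ m * g x))"
    if "hom_poly k g" for k m and g :: "real^'n \<Rightarrow> real"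
  proof -
    have "real_polynomial_function (\<lambda>x. ((norm x)\<^sup>2) ^ m * g x)"
      by (intro real_polynomial_function_hom_poly[OF hom_poly_norm_square]
          real_polynomial_function_hom_poly[OF that]
          real_polynomial_function.intros(4) real_polynomial_function_power)
    moreover from real_polynomial_function_bounded_cball[OF this, of 1] obtain C where
      "\<And>x. norm x \<le> 1 \<Longrightarrow> \<bar>((norm x)\<^sup>2) ^ m * g x\<bar> \<le> C" by metis
    ultimately show ?thesis
      by (intro integrable_indicator_bounded[where r = 1 and C = C]
          borel_measurable_real_polynomial_function) auto
  qed
  have "(1 - (norm x)\<^sup>2)\<^sup>2 * pd i h x = ((norm x)\<^sup>2) ^ 0 * pd i h x - 2 * (((norm x)\<^sup>2) ^ 1 * pd i h x) +
      ((norm x)\<^sup>2) ^ 2 * pd i h x" for x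
    by (simp add: power2_eq_square algebra_simps)
  then have "?I (\<lambda>x. (1 - (norm x)\<^sup>2)\<^sup>2 * pd i h x) =
      sph_int (pd i h) / N - 2 * (sph_int (pd i h) / (N + 2)) + sph_int (pd i h) / (N + 4)"
    using int[OF p, of 0] int[OF p, of 1] int[OF p, of 2]
      lborel_integral_ball_norm_power[OF p, of 0] lborel_integral_ball_norm_power[OF p, of 1]
      lborel_integral_ball_norm_power[OF p, of 2]
    by (simp add: N_def distrib_left right_diff_distrib mult.left_commute[of _ 2])
  moreover have "4 * (1 - (norm x)\<^sup>2) * (x $ i * h x) =
      4 * (((norm x)\<^sup>2) ^ 0 * (x $ i * h x)) - 4 * (((norm x)\<^sup>2) ^ 1 * (x $ i * h x))" for x
    by (simp add: algebra_simps)
  then have "?I (\<lambda>x. 4 * (1 - (norm x)\<^sup>2) * (x $ i * h x)) =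
      4 * (sph_int (\<lambda>x. x $ i * h x) / (N + 2)) - 4 * (sph_int (\<lambda>x. x $ i * h x) / (N + 4))"
    using int[OF q, of 0] int[OF q, of 1]
      lborel_integral_ball_norm_power[OF q, of 0] lborel_integral_ball_norm_power[OF q, of 1]
    by (simp add: N_def right_diff_distrib mult.left_commute[of _ 4] add_ac)
  moreover have "?I (\<lambda>x. (1 - (norm x)\<^sup>2)\<^sup>2 * pd i h x) = ?I (\<lambda>x. 4 * (1 - (norm x)\<^sup>2) * (x $ i * h x))"
    using lborel_integral_ball_pd[OF real_polynomial_function_hom_poly[OF h]] .
  ultimately have "sph_int (pd i h) / N - 2 * (sph_int (pd i h) / (N + 2)) + sph_int (pd i h) / (N + 4) =
      4 * (sph_int (\<lambda>x. x $ i * h x) / (N + 2)) - 4 * (sph_int (\<lambda>x. x $ i * h x) / (N + 4))"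
    by simp
  \<comment> \<open>Over the common denominator the numerators are \<open>8 a\<close> and
    \<open>8 N b\<close>.\<close>
  moreover have "a = N * b" if "a / N - 2 * (a / (N + 2)) + a / (N + 4) = 4 * (b / (N + 2)) - 4 * (b / (N + 4))"
    for a b :: real
  proof -
    have "a / N - 2 * (a / (N + 2)) + a / (N + 4) = 8 * a / (N * (N + 2) * (N + 4))"
      "4 * (b / (N + 2)) - 4 * (b / (N + 4)) = 8 * (N * b) / (N * (N + 2) * (N + 4))"
      using N by (simp_all add: divide_simps) (simp_all add: algebra_simps)
    then have "8 * a / (N * (N + 2) * (N + 4)) = 8 * (N * b) / (N * (N + 2) * (N + 4))"
      using that by simp
    moreover have "N * (N + 2) * (N + 4) \<noteq> 0" using N by simp
    ultimately show ?thesis by (simp only: divide_cancel_right) simp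
  qed
  ultimately show ?thesis by (simp add: N_def)
qed

section \<open>Integrals of spherical harmonics\<close>

lemma hom_harm_polyD:
  fixes p :: "real^'n \<Rightarrow> real"
  assumes "hom_harm_poly k p"
  shows "hom_poly k p" "laplacian p x = 0" "real_polynomial_function p"
  using assms real_polynomial_function_hom_poly unfolding hom_harm_poly_def by auto

lemma hom_harm_poly_add:
  fixes p q :: "real^'n \<Rightarrow> real"
  assumes "hom_harm_poly k p" "hom_harm_poly k q"
  shows "hom_harm_poly k (\<lambda>x. p x + q x)"
  using hom_harm_polyD[OF assms(1)] hom_harm_polyD[OF assms(2)]
  by (simp add: hom_harm_poly_def hom_poly_add laplacian_add)

lemma hom_harm_poly_cmult:
  fixes p :: "real^'n \<Rightarrow> real"
  assumes "hom_harm_poly k p"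
  shows "hom_harm_poly k (\<lambda>x. c * p x)"
  using hom_harm_polyD[OF assms] by (simp add: hom_harm_poly_def hom_poly_cmult laplacian_cmult)

lemma hom_harm_poly_diff:
  fixes p q :: "real^'n \<Rightarrow> real"
  assumes "hom_harm_poly k p" "hom_harm_poly k q"
  shows "hom_harm_poly k (\<lambda>x. p x - q x)"
  using hom_harm_poly_add[OF assms(1) hom_harm_poly_cmult[OF assms(2), of "-1"]] by simp

lemma hom_harm_poly_sum:
  fixes p :: "'a \<Rightarrow> real^'n \<Rightarrow> real"
  assumes "finite I" "\<And>j. j \<in> I \<Longrightarrow> hom_harm_poly k (p j)"
  shows "hom_harm_poly k (\<lambda>x. \<Sum>j\<in>I. p j x)"
  using assms
proof (induction I)
  case empty
  then show ?case by (simp add: hom_harm_poly_def hom_poly_zero laplacian_def)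
qed (simp add: hom_harm_poly_add)

lemma hom_harm_poly_const: "hom_harm_poly 0 (\<lambda>x::real^'n. c)"
  by (simp add: hom_harm_poly_def hom_poly_const laplacian_def)

lemma hom_harm_poly_pd:
  fixes p :: "real^'n \<Rightarrow> real"
  assumes "hom_harm_poly k p"
  shows "hom_harm_poly (k - 1) (pd i p)"
proof -
  have "laplacian p = (\<lambda>x. 0)" using hom_harm_polyD(2)[OF assms] by auto
  then show ?thesis
    using hom_harm_polyD[OF assms] hom_poly_pd[of k p i] by (simp add: hom_harm_poly_def laplacian_pd)
qed

text \<open>The degree-zero case is reduced to degree two by multiplying with \<open>|x|\<^sup>2\<close>.\<close>

lemma sph_int_pd_real:
  fixes h :: "real^'n \<Rightarrow> real"
  assumes h: "hom_poly e h"
  shows "sph_int (pd i h) = (real CARD('n) + real e - 1) * sph_int (\<lambda>x. x $ i * h x)"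
proof (cases e)
  case 0
  with h have pd0: "pd i h = (\<lambda>x. 0)" by (simp add: hom_poly_0_const)
  let ?h = "\<lambda>x. (norm x)\<^sup>2 * h x"
  have n2: "real_polynomial_function (\<lambda>x::real^'n. (norm x)\<^sup>2)"
    by (rule real_polynomial_function_hom_poly[OF hom_poly_norm_square])
  have "hom_poly (Suc 1) ?h"
    using hom_poly_mult[OF hom_poly_norm_square h] 0 by (simp add: numeral_2_eq_2)
  from sph_int_pd[OF this, of i]
  have "sph_int (\<lambda>x. 2 * (x $ i * h x)) = (CARD('n) + 1) * sph_int (\<lambda>x. x $ i * ?h x)"
    using pd0 by (simp add: pd_mult[OF n2 real_polynomial_function_hom_poly[OF h]] pd_norm_square mult.assoc)
  moreover have "sph_int (\<lambda>x. x $ i * ?h x) = sph_int (\<lambda>x. x $ i * h x)"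
    by (rule sph_int_cong) simp
  \<comment> \<open>Comparing the factors 2 and \<open>n + 1\<close> in front of the same integral
    leaves \<open>n - 1\<close>, which is the claimed factor for degree 0.\<close>
  ultimately have "(real CARD('n) - 1) * sph_int (\<lambda>x. x $ i * h x) = 0"
    unfolding sph_int_cmult by (simp add: left_diff_distrib distrib_right)
  then show ?thesis using 0 pd0 by simp
next
  case (Suc d)
  then show ?thesis using sph_int_pd[of d h i] h by simp
qed

text \<open>Integrate each \<open>pd i (pd i g)\<close> by parts, using that \<open>pd i g\<close>
  has degree \<open>d - 1\<close>, and collect the resulting sum with Euler's identity.\<close>

lemma sph_int_laplacian:
  fixes g :: "real^'n \<Rightarrow> real"
  assumes g: "hom_poly d g"
  shows "sph_int (laplacian g) = d * (real CARD('n) + real d - 2) * sph_int g"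
proof (cases "d = 0")
  case True
  then have "laplacian g = (\<lambda>x. 0)"
    using hom_poly_0_const[of g] g by (auto simp: laplacian_def[abs_def])
  then show ?thesis using True by simp
next
  case False
  note rpf = real_polynomial_function_hom_poly[OF g]
  have "sph_int (laplacian g) = (\<Sum>i\<in>UNIV. sph_int (pd i (pd i g)))"
    using rpf by (simp add: laplacian_def[abs_def] sph_int_sum real_polynomial_function_pd)
  also have "\<dots> = (\<Sum>i\<in>UNIV. (real CARD('n) + real d - 2) * sph_int (\<lambda>x. x $ i * pd i g x))"
    using False by (intro sum.cong refl) (simp add: sph_int_pd_real[OF hom_poly_pd[OF g]] of_nat_diff)
  also have "\<dots> = (real CARD('n) + real d - 2) * sph_int (\<lambda>x. \<Sum>i\<in>UNIV. x $ i * pd i g x)"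
    using rpf by (simp add: sph_int_sum real_polynomial_function_pd rpf_intros sum_distrib_left)
  finally show ?thesis by (simp add: hom_poly_euler[OF g] sph_int_cmult)
qed

text \<open>Green's second identity: the field \<open>p \<nabla>q - q \<nabla>p\<close> is
  divergence free, and its product with the position vector is \<open>(b - a) p q\<close>.
  Integrating its divergence gives a nonzero multiple of \<open>\<integral> p q\<close>;
  \<open>n \<ge> 2\<close> keeps the factor \<open>n + e - 1\<close> positive.\<close>

lemma sph_int_harmonic_orthogonal:
  fixes p q :: "real^'n \<Rightarrow> real"
  assumes "CARD('n) \<ge> 2" and p: "hom_harm_poly a p" and q: "hom_harm_poly b q" and "a \<noteq> b"
  shows "sph_int (\<lambda>x. p x * q x) = 0"
proof -
  define e where "e = a + b - 1"
  define h where "h i x = p x * pd i q x - q x * pd i p x" for i x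
  note p' = hom_harm_polyD[OF p] and q' = hom_harm_polyD[OF q]
  \<comment> \<open>A constant factor has zero gradient, so its truncated degree does no harm; since
    \<open>a \<noteq> b\<close>, the sum \<open>a + b\<close> is positive and \<open>e\<close>
    itself is not truncated.\<close>
  have "hom_poly e (\<lambda>x. p x * pd i q x)" for i
  proof (cases "b = 0")
    case True
    then show ?thesis using hom_poly_0_const[of q i] q' by (simp add: hom_poly_zero)
  next
    case False
    then show ?thesis using hom_poly_mult[OF p'(1) hom_poly_pd[OF q'(1)]] by (simp add: e_def)
  qed
  moreover have "hom_poly e (\<lambda>x. q x * pd i p x)" for i
  proof (cases "a = 0")
    case True
    then show ?thesis using hom_poly_0_const[of p i] p' by (simp add: hom_poly_zero)
  next
    case False
    then show ?thesis using hom_poly_mult[OF q'(1) hom_poly_pd[OF p'(1)]] by (simp add: e_def add_ac)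
  qed
  ultimately have h: "hom_poly e (h i)" for i
    unfolding h_def by (rule hom_poly_diff)
  note h' = real_polynomial_function_hom_poly[OF h]
  have "(\<Sum>i\<in>UNIV. pd i (h i) x) = p x * laplacian q x - q x * laplacian p x" for x
    using p'(3) q'(3)
    by (simp add: h_def[abs_def] pd_diff pd_mult rpf_intros real_polynomial_function_pd
        laplacian_def sum_distrib_left flip: sum_subtractf)
  then have "(\<Sum>i\<in>UNIV. pd i (h i) x) = 0" for x
    by (simp add: p'(2) q'(2))
  then have "0 = sph_int (\<lambda>x. \<Sum>i\<in>UNIV. pd i (h i) x)" by simp
  also have "\<dots> = (\<Sum>i\<in>UNIV. sph_int (pd i (h i)))"
    by (simp add: sph_int_sum real_polynomial_function_pd h')
  also have "\<dots> = (real CARD('n) + real e - 1) * sph_int (\<lambda>x. \<Sum>i\<in>UNIV. x $ i * h i x)"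
    by (simp add: sph_int_pd_real[OF h] sph_int_sum h' rpf_intros sum_distrib_left)
  also have "(\<lambda>x. \<Sum>i\<in>UNIV. x $ i * h i x) = (\<lambda>x. (real b - real a) * (p x * q x))"
  proof
    fix x :: "real^'n"
    have "(\<Sum>i\<in>UNIV. x $ i * h i x) =
        p x * (\<Sum>i\<in>UNIV. x $ i * pd i q x) - q x * (\<Sum>i\<in>UNIV. x $ i * pd i p x)"
      by (simp add: h_def sum_distrib_left algebra_simps flip: sum_subtractf)
    then show "(\<Sum>i\<in>UNIV. x $ i * h i x) = (real b - real a) * (p x * q x)"
      by (simp add: hom_poly_euler[OF p'(1)] hom_poly_euler[OF q'(1)] algebra_simps)
  qed
  finally have "(real CARD('n) + real e - 1) * ((real b - real a) * sph_int (\<lambda>x. p x * q x)) = 0"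
    by (simp add: sph_int_cmult)
  moreover have "real CARD('n) + real e - 1 \<noteq> 0" using assms(1) by linarith
  ultimately show ?thesis using \<open>a \<noteq> b\<close> by simp
qed

text \<open>Orthogonality to the constant 1, which is harmonic of degree 0.\<close>

lemma sph_int_harmonic_eq_0:
  fixes p :: "real^'n \<Rightarrow> real"
  assumes "CARD('n) \<ge> 2" "hom_harm_poly k p" "k \<ge> 1"
  shows "sph_int p = 0"
  using sph_int_harmonic_orthogonal[OF assms(1,2) hom_harm_poly_const[of 1]] assms(3) by simp

text \<open>For harmonic factors \<open>\<Delta>(p q) = 2 \<nabla>p \<bullet> \<nabla>q\<close>, and
  \<open>p q\<close> has degree \<open>2 k\<close>; \<open>sph_int_laplacian\<close> then gives
  twice the claim.\<close>

lemma sph_int_grad_harmonic: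
  fixes p q :: "real^'n \<Rightarrow> real"
  assumes p: "hom_harm_poly k p" and q: "hom_harm_poly k q"
  shows "sph_int (\<lambda>x. \<Sum>i\<in>UNIV. pd i p x * pd i q x) =
    k * (real CARD('n) + 2 * real k - 2) * sph_int (\<lambda>x. p x * q x)"
proof -
  note p' = hom_harm_polyD[OF p] and q' = hom_harm_polyD[OF q]
  have "laplacian (\<lambda>x. p x * q x) = (\<lambda>x. 2 * (\<Sum>i\<in>UNIV. pd i p x * pd i q x))"
    by (rule ext) (simp add: laplacian_mult p' q')
  then show ?thesis
    using sph_int_laplacian[OF hom_poly_mult[OF p'(1) q'(1)]] by (simp add: sph_int_cmult)
qed

lemma hom_poly_eq_0_if_eq_0_on_ball:
  fixes g :: "real^'n \<Rightarrow> real"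
  assumes g: "hom_poly d g" and "\<And>y. y \<in> ball 0 1 \<Longrightarrow> g y = 0"
  shows "g x = 0"
proof -
  \<comment> \<open>This positive factor scales \<open>x\<close> into the unit ball, and homogeneity
    carries the zero back to \<open>x\<close>.\<close>
  define t where "t = 1 / (2 + 2 * norm x)"
  have "2 + 2 * norm x > 0" using norm_ge_zero[of x] by linarith
  then have t: "t > 0" "norm (t *\<^sub>R x) < 1" by (simp_all add: t_def divide_simps)
  then show ?thesis
    using assms(2)[of "t *\<^sub>R x"] by (simp add: hom_poly_scaleR[OF g])
qed

text \<open>The ball integral vanishes together with the sphere integral, so \<open>g\<close> is
  zero almost everywhere on the ball. A point with \<open>g > 0\<close> there would have an open
  neighbourhood of such points, which cannot be negligible.\<close>

lemma hom_poly_eq_0_if_sph_int_eq_0: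
  fixes g :: "real^'n \<Rightarrow> real"
  assumes g: "hom_poly d g" and nonneg: "\<And>x. g x \<ge> 0" and "sph_int g = 0"
  shows "g x = 0"
proof (rule hom_poly_eq_0_if_eq_0_on_ball[OF g], rule ccontr)
  fix y :: "real^'n"
  assume y: "y \<in> ball 0 1" "g y \<noteq> 0"
  note rpf = real_polynomial_function_hom_poly[OF g]
  let ?f = "\<lambda>x. indicator (ball 0 1) x * g x"
  obtain C where "\<And>x. norm x \<le> 1 \<Longrightarrow> \<bar>g x\<bar> \<le> C"
    using real_polynomial_function_bounded_cball[OF rpf, of 1] by metis
  then have int: "integrable lborel ?f"
    by (intro integrable_indicator_bounded[where r = 1 and C = C]
        borel_measurable_real_polynomial_function rpf) auto
  have "real (CARD('n) + d) \<noteq> 0" unfolding of_nat_eq_0_iff by simp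
  then have "(LINT x|lborel. ?f x) = 0"
    using sph_int_hom_poly[OF g] assms(3) by (metis mult_eq_0_iff)
  then have "AE x in lborel. ?f x = 0"
    using integral_nonneg_eq_0_iff_AE[OF int] nonneg by simp
  then obtain N where N: "{x. ?f x \<noteq> 0} \<subseteq> N" "N \<in> null_sets lborel"
    by (auto elim!: AE_E simp: null_sets_def)
  define S where "S = ball 0 1 \<inter> {x. 0 < g x}"
  have "continuous_on UNIV g"
    using rpf by (intro continuous_on_polymonial_function) (simp add: real_polynomial_function_eq)
  then have "open S"
    unfolding S_def by (intro open_Int open_ball open_Collect_less continuous_on_const)
  moreover have "S \<subseteq> N" using N(1) by (auto simp: S_def)
  then have "negligible S"
    using N(2) negligible_subset negligible_iff_null_sets null_sets_completionI by blast
  moreover have "y \<in> S" using y nonneg[of y] by (simp add: S_def)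
  ultimately show False using open_not_negligible by blast
qed

section \<open>Uniqueness of the harmonic extension\<close>

text \<open>If \<open>D > 0\<close>, then \<open>g'\<close> is positive just to the right of its
  zero at 0, and the mean value theorem yields values of \<open>g\<close> above
  \<open>g 0\<close>.\<close>

lemma second_derivative_le_0_at_max:
  fixes g g' :: "real \<Rightarrow> real"
  assumes "\<epsilon> > 0" and g: "\<And>t. \<bar>t\<bar> < \<epsilon> \<Longrightarrow> (g has_real_derivative g' t) (at t)"
    and g': "(g' has_real_derivative D) (at 0)" and max: "\<And>t. \<bar>t\<bar> < \<epsilon> \<Longrightarrow> g t \<le> g 0"
  shows "D \<le> 0"
proof (rule ccontr)
  assume "\<not> D \<le> 0"
  then obtain d where d: "d > 0" "\<And>h. 0 < h \<Longrightarrow> h < d \<Longrightarrow> g' 0 < g' (0 + h)"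
    using DERIV_pos_inc_right[OF g'] by auto
  have "g' 0 = 0"
    using DERIV_local_max[OF g[of 0] \<open>\<epsilon> > 0\<close>] max \<open>\<epsilon> > 0\<close> by simp
  define h where "h = min d \<epsilon> / 2"
  have h: "0 < h" "h < d" "h < \<epsilon>" using d \<open>\<epsilon> > 0\<close> by (auto simp: h_def)
  obtain z where z: "0 < z" "z < h" "g h - g 0 = (h - 0) * g' z"
    using MVT2[of 0 h g g'] h g by auto
  have "g' z > 0" using d(2)[of z] z h \<open>g' 0 = 0\<close> by simp
  then have "g h > g 0" using z h by (smt (verit) mult_pos_pos)
  then show False using max[of h] h by simp
qed

lemma pd_cong_open:
  fixes f g :: "real^'n \<Rightarrow> real"
  assumes "open S" "x \<in> S" "\<And>y. y \<in> S \<Longrightarrow> f y = g y"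
  shows "pd i f x = pd i g x"
  unfolding pd_def
proof (rule deriv_cong_ev)
  have "open ((\<lambda>t. x + t *\<^sub>R axis i 1) -` S)"
    using \<open>open S\<close> by (intro open_vimage continuous_intros)
  then have "\<forall>\<^sub>F t in nhds 0. t \<in> (\<lambda>t. x + t *\<^sub>R axis i 1) -` S"
    using \<open>x \<in> S\<close> by (intro eventually_nhds_in_open) auto
  then show "\<forall>\<^sub>F t in nhds 0. f (x + t *\<^sub>R axis i 1) = g (x + t *\<^sub>R axis i 1)"
    by eventually_elim (simp add: assms(3))
qed simp

text \<open>Needed because the function returned by \<open>harm_ext\<close> is cut off to zero
  outside the closed ball and agrees with a polynomial only inside.\<close>

lemma harmonic_on_cong:
  fixes f g :: "real^'n \<Rightarrow> real"
  assumes "open S" and eq: "\<And>y. y \<in> S \<Longrightarrow> f y = g y" and f: "harmonic_on S f"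
  shows "harmonic_on S g"
proof -
  have pd: "pd i f y = pd i g y" if "y \<in> S" for i y
    using pd_cong_open[OF \<open>open S\<close> that eq] by simp
  have pd2: "pd j (pd i f) y = pd j (pd i g) y" if "y \<in> S" for i j y
    using pd_cong_open[OF \<open>open S\<close> that pd] by simp
  have diff: "u differentiable_on S \<Longrightarrow> v differentiable_on S" if "\<And>y. y \<in> S \<Longrightarrow> u y = v y"
    for u v :: "real^'n \<Rightarrow> real"
    using that by (metis differentiable_on_def differentiable_transform_within zero_less_one)
  have "g differentiable_on S"
    by (rule diff[OF eq]) (use f in \<open>simp_all add: harmonic_on_def\<close>)
  moreover have "pd i g differentiable_on S" for i
    by (rule diff[OF pd]) (use f in \<open>simp_all add: harmonic_on_def\<close>)
  moreover have "continuous_on S (pd j (pd i g))" for i j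
    by (rule continuous_on_eq[of S "pd j (pd i f)"]) (use f pd2 in \<open>auto simp: harmonic_on_def\<close>)
  moreover have "laplacian g y = 0" if "y \<in> S" for y
  proof -
    have "laplacian g y = laplacian f y" using pd2[OF that] by (simp add: laplacian_def)
    then show ?thesis using f that by (simp add: harmonic_on_def)
  qed
  ultimately show ?thesis by (simp add: harmonic_on_def)
qed

text \<open>Weak maximum principle: adding a small multiple of \<open>|x|^2\<close> to
  \<open>u - v\<close> makes the Laplacian strictly positive, which excludes an interior
  maximum.\<close>

lemma harmonic_le_if_le_on_sphere:
  fixes u v :: "real^'n \<Rightarrow> real"
  assumes u: "continuous_on (cball 0 1) u" "harmonic_on (ball 0 1) u"
    and v: "continuous_on (cball 0 1) v" "harmonic_on (ball 0 1) v"
    and le: "\<And>x. x \<in> sphere 0 1 \<Longrightarrow> u x \<le> v x" and x: "x \<in> cball 0 1"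
  shows "u x \<le> v x"
proof (rule ccontr)
  assume "\<not> u x \<le> v x"
  define \<delta> where "\<delta> = u x - v x"
  have "\<delta> > 0" using \<open>\<not> u x \<le> v x\<close> by (simp add: \<delta>_def)
  \<comment> \<open>The factor \<open>\<delta> / 2\<close> is small enough that
    \<open>w \<le> \<delta> / 2\<close> on the sphere, below \<open>w x \<ge> \<delta>\<close>; it
    contributes exactly \<open>\<delta>\<close> to each pure second derivative.\<close>
  define w where "w y = u y - v y + \<delta> / 2 * (norm y)\<^sup>2" for y
  have "continuous_on (cball 0 1) w"
    unfolding w_def by (intro continuous_intros u v)
  then obtain z where z: "z \<in> cball 0 1" "\<And>y. y \<in> cball 0 1 \<Longrightarrow> w y \<le> w z"
    using continuous_attains_sup[of "cball (0::real^'n) 1" w] by auto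
  have "w x \<ge> \<delta>"
    using \<open>\<delta> > 0\<close> unfolding w_def \<delta>_def[symmetric] by simp
  then have "w z \<ge> \<delta>" using z(2)[OF x] by linarith
  have "norm z \<noteq> 1"
  proof
    assume "norm z = 1"
    then show False using \<open>w z \<ge> \<delta>\<close> le[of z] \<open>\<delta> > 0\<close> by (simp add: w_def)
  qed
  then have zb: "norm z < 1" using z(1) by simp
  have "pd i (pd i u) z - pd i (pd i v) z + \<delta> \<le> 0" for i
  proof (rule second_derivative_le_0_at_max)
    let ?l = "\<lambda>t. z + t *\<^sub>R axis i 1"
    show "1 - norm z > 0" using zb by simp
    have in_ball: "?l t \<in> ball 0 1" if "\<bar>t\<bar> < 1 - norm z" for t
      using that norm_triangle_ineq[of z "t *\<^sub>R axis i 1"] by simp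
    have n2: "real_polynomial_function (\<lambda>x::real^'n. (norm x)\<^sup>2)"
      by (rule real_polynomial_function_hom_poly[OF hom_poly_norm_square])
    have D: "((\<lambda>t. f (?l t)) has_real_derivative pd i f (?l t)) (at t)"
      if "f differentiable_on ball 0 1" "\<bar>t\<bar> < 1 - norm z" for f and t
      using that in_ball[OF that(2)] differentiable_on_eq_differentiable_at[OF open_ball, of f]
      by (intro differentiable_has_real_derivative_pd) blast
    show "((\<lambda>t. w (?l t)) has_real_derivative (pd i u (?l t) - pd i v (?l t) + \<delta> * ?l t $ i)) (at t)"
      if "\<bar>t\<bar> < 1 - norm z" for t
    proof -
      have n: "((\<lambda>t. \<delta> / 2 * (norm (?l t))\<^sup>2) has_real_derivative \<delta> / 2 * (2 * ?l t $ i)) (at t)"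
        using differentiable_has_real_derivative_pd[OF differentiable_at_real_polynomial_function[OF n2], of z i t]
        unfolding pd_norm_square by (rule DERIV_cmult)
      have uv: "((\<lambda>t. u (?l t)) has_real_derivative pd i u (?l t)) (at t)"
        "((\<lambda>t. v (?l t)) has_real_derivative pd i v (?l t)) (at t)"
        using u(2) v(2) that by (auto simp: harmonic_on_def intro!: D)
      show ?thesis
        unfolding w_def by (rule DERIV_cong[OF DERIV_add[OF DERIV_diff[OF uv] n]]) simp
    qed
    have "((\<lambda>t. pd i u (?l t)) has_real_derivative pd i (pd i u) z) (at 0)"
      "((\<lambda>t. pd i v (?l t)) has_real_derivative pd i (pd i v) z) (at 0)"
      using u(2) v(2) zb D[of "pd i u" 0] D[of "pd i v" 0] by (auto simp: harmonic_on_def)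
    then show "((\<lambda>t. pd i u (?l t) - pd i v (?l t) + \<delta> * ?l t $ i) has_real_derivative
        pd i (pd i u) z - pd i (pd i v) z + \<delta>) (at 0)"
      by (auto intro!: derivative_eq_intros simp: axis_def)
    show "w (?l t) \<le> w (?l 0)" if "\<bar>t\<bar> < 1 - norm z" for t
      using z(2)[of "?l t"] in_ball[OF that] by simp
  qed
  \<comment> \<open>Summed over all directions the harmonic terms cancel and
    \<open>n * \<delta> \<le> 0\<close> remains.\<close>
  then have "(\<Sum>i\<in>UNIV. pd i (pd i u) z - pd i (pd i v) z + \<delta>) \<le> 0"
    by (intro sum_nonpos) auto
  also have "(\<Sum>i\<in>UNIV. pd i (pd i u) z - pd i (pd i v) z + \<delta>) = CARD('n) * \<delta>"
    using u(2) v(2) zb by (simp add: harmonic_on_def laplacian_def sum.distrib sum_subtractf)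
  finally show False using \<open>\<delta> > 0\<close> by (simp add: mult_le_0_iff)
qed

lemma harmonic_on_polynomial:
  fixes p :: "real^'n \<Rightarrow> real"
  assumes "real_polynomial_function p" "\<And>x. laplacian p x = 0"
  shows "harmonic_on S p"
  using assms
  by (simp add: harmonic_on_def differentiable_on_real_polynomial_function real_polynomial_function_pd
      continuous_on_polymonial_function flip: real_polynomial_function_eq)

lemma harm_ext_polynomial:
  fixes p :: "real^'n \<Rightarrow> real"
  assumes p: "real_polynomial_function p" "\<And>x. laplacian p x = 0"
    and eq: "\<And>x. x \<in> sphere 0 1 \<Longrightarrow> f x = p x"
  shows "harm_ext f = (\<lambda>x. if x \<in> cball 0 1 then p x else 0)"
  unfolding harm_ext_def
proof (rule the_equality, intro conjI)
  let ?u = "\<lambda>x. if x \<in> cball 0 1 then p x else 0"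
  show cont: "continuous_on (cball 0 1) ?u"
    using p by (subst continuous_on_cong[OF refl, of _ _ p])
      (auto intro!: continuous_on_polymonial_function simp flip: real_polynomial_function_eq)
  show harm: "harmonic_on (ball 0 1) ?u"
    by (rule harmonic_on_cong[OF open_ball _ harmonic_on_polynomial[OF p]]) auto
  show "\<forall>x\<in>sphere 0 1. ?u x = f x" using eq by simp
  show "\<forall>x. x \<notin> cball 0 1 \<longrightarrow> ?u x = 0" by simp
  fix v
  assume v: "continuous_on (cball 0 1) v \<and> harmonic_on (ball 0 1) v \<and>
    (\<forall>x\<in>sphere 0 1. v x = f x) \<and> (\<forall>x. x \<notin> cball 0 1 \<longrightarrow> v x = 0)"
  \<comment> \<open>Comparison in both directions gives uniqueness on the closed ball; outside it
    both functions are prescribed to be 0, so the description in \<open>harm_ext\<close> determines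
    a total function.\<close>
  have "v x = ?u x" if "x \<in> cball 0 1" for x
    using harmonic_le_if_le_on_sphere[OF cont harm _ _ _ that, of v]
      harmonic_le_if_le_on_sphere[OF _ _ cont harm _ that, of v] v eq by fastforce
  then show "v = ?u" using v by auto
qed

section \<open>Tangential derivatives and the operator A\<close>

lemma
  fixes x :: "real^'n"
  shows tframe_orthogonal: "\<And>v. v \<in> tframe x \<Longrightarrow> v \<bullet> x = 0"
    and tframe_pairwise: "pairwise orthogonal (tframe x)"
    and tframe_norm: "\<And>v. v \<in> tframe x \<Longrightarrow> norm v = 1"
    and tframe_span: "span (tframe x) = {v. v \<bullet> x = 0}"
    and tframe_finite: "finite (tframe x)"
proof -
  obtain B where "B \<subseteq> {v. v \<bullet> x = 0}" "pairwise orthogonal B" "\<And>v. v \<in> B \<Longrightarrow> norm v = 1"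
    "span B = {v. v \<bullet> x = 0}"
    using orthonormal_basis_subspace[OF subspace_hyperplane2] by metis
  then have "\<exists>B. B \<subseteq> {v. v \<bullet> x = 0} \<and> pairwise orthogonal B \<and> (\<forall>v\<in>B. norm v = 1) \<and>
      span B = {v. v \<bullet> x = 0}" by blast
  from someI_ex[OF this, folded tframe_def]
  show "\<And>v. v \<in> tframe x \<Longrightarrow> v \<bullet> x = 0" "pairwise orthogonal (tframe x)"
    "\<And>v. v \<in> tframe x \<Longrightarrow> norm v = 1" "span (tframe x) = {v. v \<bullet> x = 0}"
    by auto
  then show "finite (tframe x)" by (intro pairwise_orthogonal_imp_finite)
qed

text \<open>The difference of the two sides lies in the span of the frame and is orthogonal to the
  frame, hence to itself. Sums over the chosen frame thus become the tangential projection,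
  whichever frame was chosen.\<close>

lemma tframe_expansion:
  fixes x v :: "real^'n"
  assumes "norm x = 1"
  shows "(\<Sum>\<tau>\<in>tframe x. (v \<bullet> \<tau>) *\<^sub>R \<tau>) = v - (v \<bullet> x) *\<^sub>R x"
proof -
  define u where "u = (\<Sum>\<tau>\<in>tframe x. (v \<bullet> \<tau>) *\<^sub>R \<tau>)"
  define w where "w = v - (v \<bullet> x) *\<^sub>R x - u"
  have orth: "orthogonal w b" if b: "b \<in> tframe x" for b
  proof -
    have "u \<bullet> b = (\<Sum>\<tau>\<in>tframe x. (v \<bullet> \<tau>) * (\<tau> \<bullet> b))"
      by (simp add: u_def inner_sum_left)
    also have "\<dots> = (\<Sum>\<tau>\<in>tframe x. if \<tau> = b then v \<bullet> b else 0)"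
      using b tframe_pairwise[of x] tframe_norm[OF b]
      by (intro sum.cong refl) (auto simp: pairwise_def orthogonal_def norm_eq_1)
    also have "\<dots> = v \<bullet> b" using b by (simp add: tframe_finite)
    finally show ?thesis
      using tframe_orthogonal[OF b] by (simp add: w_def orthogonal_def inner_diff_left inner_diff_right inner_commute)
  qed
  have "w \<in> span (tframe x)"
  proof -
    have "x \<bullet> x = 1" using assms by (simp add: norm_eq_1)
    moreover have "u \<in> span (tframe x)"
      unfolding u_def by (intro span_sum span_mul span_base)
    ultimately show ?thesis
      unfolding w_def tframe_span by (simp add: inner_diff_left)
  qed
  then have "orthogonal w w" using orth by (rule orthogonal_to_span)
  then show ?thesis by (simp add: orthogonal_self w_def u_def)
qed

text \<open>The normalised line stays on the sphere, so only the values of \<open>F\<close> there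
  matter. Its velocity at 0 is \<open>\<tau>\<close>, because the norm has zero derivative in a
  direction orthogonal to \<open>x\<close>; the chain rule finishes.\<close>

lemma dT_eq:
  fixes f F :: "real^'n \<Rightarrow> 'b::real_normed_vector"
  assumes "norm x = 1" "\<tau> \<bullet> x = 0" and eq: "\<And>y. y \<in> sphere 0 1 \<Longrightarrow> f y = F y"
    and F: "(F has_derivative F') (at x)"
  shows "dT \<tau> f x = F' \<tau>"
proof -
  let ?\<gamma> = "\<lambda>t. (x + t *\<^sub>R \<tau>) /\<^sub>R norm (x + t *\<^sub>R \<tau>)"
  have xx: "x \<bullet> x = 1" using assms(1) by (simp add: norm_eq_1)
  have "x + t *\<^sub>R \<tau> \<noteq> 0" for t
  proof
    assume "x + t *\<^sub>R \<tau> = 0"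
    then have "(x + t *\<^sub>R \<tau>) \<bullet> x = 0" by simp
    then show False using assms(2) xx by (simp add: inner_add_left)
  qed
  then have \<gamma>: "?\<gamma> t \<in> sphere 0 1" for t by simp
  have line: "((\<lambda>t. x + t *\<^sub>R \<tau>) has_derivative (\<lambda>t. t *\<^sub>R \<tau>)) (at 0)"
    by (auto intro!: derivative_eq_intros)
  have "x \<noteq> 0" using assms(1) by auto
  then have "(norm has_derivative (\<lambda>y. y \<bullet> sgn x)) (at (x + 0 *\<^sub>R \<tau>))"
    by (simp add: has_derivative_norm)
  from has_derivative_compose[OF line this]
  have "((\<lambda>t. norm (x + t *\<^sub>R \<tau>)) has_derivative (\<lambda>t. 0)) (at 0)"
    using assms by (simp add: sgn_div_norm)
  then have "((\<lambda>t. norm (x + t *\<^sub>R \<tau>)) has_real_derivative 0) (at 0)"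
    by (simp add: has_field_derivative_def lambda_zero)
  then have "((\<lambda>t. inverse (norm (x + t *\<^sub>R \<tau>))) has_real_derivative 0) (at 0)"
    using DERIV_inverse_fun[of "\<lambda>t. norm (x + t *\<^sub>R \<tau>)" 0 0 UNIV] assms(1) by simp
  moreover have "((\<lambda>t. x + t *\<^sub>R \<tau>) has_vector_derivative \<tau>) (at 0)"
    using line by (simp add: has_vector_derivative_def)
  ultimately have "(?\<gamma> has_vector_derivative \<tau>) (at 0)"
    using has_vector_derivative_scaleR[of "\<lambda>t. inverse (norm (x + t *\<^sub>R \<tau>))" 0 0 UNIV
        "\<lambda>t. x + t *\<^sub>R \<tau>" \<tau>] assms(1) by simp
  then have "(?\<gamma> has_derivative (\<lambda>t. t *\<^sub>R \<tau>)) (at 0)"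
    by (simp add: has_vector_derivative_def)
  moreover have "(F has_derivative F') (at (?\<gamma> 0))" using F assms(1) by simp
  ultimately have "((\<lambda>t. F (?\<gamma> t)) has_derivative (\<lambda>t. F' (t *\<^sub>R \<tau>))) (at 0)"
    by (rule has_derivative_compose)
  then have "((\<lambda>t. F (?\<gamma> t)) has_vector_derivative F' \<tau>) (at 0)"
    using linear_cmul[OF has_derivative_linear[OF F]] by (simp add: has_vector_derivative_def)
  then show ?thesis
    unfolding dT_def eq[OF \<gamma>] by (rule vector_derivative_at)
qed

text \<open>The tangential gradient is the projection of the Euclidean one, and Euler's identity
  evaluates the radial component as \<open>k * p x\<close>.\<close>

lemma gradT_eq:
  fixes f p :: "real^'n \<Rightarrow> real"
  assumes x: "norm x = 1" and eq: "\<And>y. y \<in> sphere 0 1 \<Longrightarrow> f y = p y"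
    and p: "hom_poly k p"
  shows "gradT f x = (\<chi> i. pd i p x) - (k * p x) *\<^sub>R x"
proof -
  let ?g = "(\<chi> i. pd i p x) :: real^'n"
  have "dT \<tau> f x = ?g \<bullet> \<tau>" if "\<tau> \<in> tframe x" for \<tau>
    using dT_eq[OF x tframe_orthogonal[OF that] eq has_derivative_pd[OF real_polynomial_function_hom_poly[OF p]]]
    by (simp add: inner_vec_def mult.commute)
  then have "gradT f x = ?g - (?g \<bullet> x) *\<^sub>R x"
    by (simp add: gradT_def tframe_expansion[OF x])
  also have "?g \<bullet> x = k * p x"
    using hom_poly_euler[OF p, of x] by (simp add: inner_vec_def mult.commute)
  finally show ?thesis .
qed

lemma divS_eq_sum_gradT:
  fixes w :: "real^'n \<Rightarrow> real^'n"
  assumes x: "norm x = 1" and eq: "\<And>y j. y \<in> sphere 0 1 \<Longrightarrow> w y $ j = P j y"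
    and P: "\<And>j. real_polynomial_function (P j)"
  shows "divS w x = (\<Sum>j\<in>UNIV. gradT (\<lambda>y. w y $ j) x $ j)"
proof -
  have D: "((\<lambda>y. \<chi> j. P j y) has_derivative (\<lambda>v. \<chi> j. \<Sum>i\<in>UNIV. v $ i * pd i (P j) x)) (at x)"
    unfolding has_derivative_componentwise_within[of "\<lambda>y. \<chi> j. P j y"]
    by (auto simp: Basis_vec_def inner_axis intro!: has_derivative_pd P)
  have w: "w y = (\<chi> j. P j y)" if "y \<in> sphere 0 1" for y
    using eq[OF that] by (simp add: vec_eq_iff)
  have "dT \<tau> w x $ j = dT \<tau> (\<lambda>y. w y $ j) x" if "\<tau> \<in> tframe x" for \<tau> j
    using dT_eq[OF x tframe_orthogonal[OF that] w D]
      dT_eq[OF x tframe_orthogonal[OF that] eq has_derivative_pd[OF P], of j] by simp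
  then have "divS w x = (\<Sum>\<tau>\<in>tframe x. \<Sum>j\<in>UNIV. dT \<tau> (\<lambda>y. w y $ j) x * \<tau> $ j)"
    by (simp add: divS_def inner_vec_def)
  also have "\<dots> = (\<Sum>j\<in>UNIV. \<Sum>\<tau>\<in>tframe x. dT \<tau> (\<lambda>y. w y $ j) x * \<tau> $ j)"
    by (rule sum.swap)
  finally show ?thesis by (simp add: gradT_def)
qed

text \<open>The radial corrections \<open>k * ?s * x $ i\<close> from the divergence and from the
  gradients cancel. The extra \<open>P i x\<close> compensates the term that arises when the
  position vector is differentiated in \<open>\<langle>x, P\<rangle>\<close>.\<close>

lemma opA_component:
  fixes w :: "real^'n \<Rightarrow> real^'n"
  assumes x: "norm x = 1" and eq: "\<And>y j. y \<in> sphere 0 1 \<Longrightarrow> w y $ j = P j y"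
    and P: "\<And>j. hom_poly k (P j)"
  shows "opA w x $ i =
    (\<Sum>j\<in>UNIV. pd j (P j) x) * x $ i - pd i (\<lambda>x. \<Sum>j\<in>UNIV. x $ j * P j x) x + P i x"
proof -
  let ?s = "\<Sum>j\<in>UNIV. x $ j * P j x"
  note rpf = real_polynomial_function_hom_poly[OF P]
  have g: "gradT (\<lambda>y. w y $ j) x $ i = pd i (P j) x - k * P j x * x $ i" for i j
    using gradT_eq[of x "\<lambda>y. w y $ j" "P j", OF x eq P] by simp
  have "divS w x = (\<Sum>j\<in>UNIV. pd j (P j) x) - k * ?s"
    using divS_eq_sum_gradT[where P = P, OF x eq rpf]
    by (simp add: g sum_subtractf sum_distrib_left mult_ac)
  moreover have "(\<Sum>j\<in>UNIV. x $ j * (pd i (P j) x - k * P j x * x $ i)) =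
      (\<Sum>j\<in>UNIV. x $ j * pd i (P j) x) - k * ?s * x $ i"
    by (simp add: right_diff_distrib sum_subtractf sum_distrib_left sum_distrib_right mult_ac)
  moreover have "pd i (\<lambda>x. \<Sum>j\<in>UNIV. x $ j * P j x) x = P i x + (\<Sum>j\<in>UNIV. x $ j * pd i (P j) x)"
    by (simp add: pd_sum pd_mult pd_component rpf rpf_intros sum.distrib mult_delta_left)
  ultimately show ?thesis
    by (simp add: opA_def g left_diff_distrib)
qed

section \<open>Solenoidal maps\<close>

text \<open>Coordinates are harmonic with constant gradient, so only the mixed term of the product
  rule survives. Divergence freeness thus becomes harmonicity of
  \<open>\<langle>x, P\<rangle>\<close>.\<close>

lemma laplacian_inner_position:
  fixes P :: "'n::finite \<Rightarrow> real^'n \<Rightarrow> real"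
  assumes P: "\<And>j. hom_harm_poly k (P j)"
  shows "laplacian (\<lambda>x. \<Sum>j\<in>UNIV. x $ j * P j x) x = 2 * (\<Sum>j\<in>UNIV. pd j (P j) x)"
proof -
  note rpf = hom_harm_polyD(3)[OF P]
  have "laplacian (\<lambda>x. x $ j) x = 0" for j
    by (simp add: laplacian_def pd_component)
  then have "laplacian (\<lambda>x. x $ j * P j x) x = 2 * pd j (P j) x" for j
    by (simp add: laplacian_mult rpf rpf_intros hom_harm_polyD(2)[OF P] pd_component mult_delta_left)
  then show ?thesis
    by (simp add: laplacian_sum rpf rpf_intros sum_distrib_left)
qed

lemma hom_harm_poly_inner_position:
  fixes P :: "'n::finite \<Rightarrow> real^'n \<Rightarrow> real"
  assumes P: "\<And>j. hom_harm_poly k (P j)" and "\<And>x. (\<Sum>j\<in>UNIV. pd j (P j) x) = 0"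
  shows "hom_harm_poly (Suc k) (\<lambda>x. \<Sum>j\<in>UNIV. x $ j * P j x)"
proof -
  have "hom_poly (1 + k) (\<lambda>x. \<Sum>j\<in>UNIV. x $ j * P j x)"
    by (intro hom_poly_sum hom_poly_mult hom_poly_component hom_harm_polyD(1) P)
  then show ?thesis
    using laplacian_inner_position[OF P] assms(2) by (simp add: hom_harm_poly_def)
qed

lemma sph_int_vec:
  fixes P :: "'m::finite \<Rightarrow> real^'n \<Rightarrow> real"
  assumes "\<And>j. real_polynomial_function (P j)"
  shows "sph_int (\<lambda>x. \<chi> j. P j x) $ j = sph_int (P j)"
proof -
  have "(\<lambda>x. \<chi> j. P j (x /\<^sub>R norm x)) integrable_on ball 0 1"
    by (rule integrable_componentwise)
      (auto simp: Basis_vec_def inner_axis intro!: integrable_on_radial_projection assms)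
  from integral_component_eq_cart[OF this, of j] show ?thesis
    by (simp add: sph_int_def)
qed

lemma harm_ext_vec_divergence:
  fixes w :: "real^'n \<Rightarrow> real^'n"
  assumes P: "\<And>j. hom_harm_poly k (P j)" and eq: "\<And>x j. x \<in> sphere 0 1 \<Longrightarrow> w x $ j = P j x"
    and x: "x \<in> ball 0 1"
  shows "vdiv (harm_ext_vec w) x = (\<Sum>j\<in>UNIV. pd j (P j) x)"
proof -
  have "harm_ext (\<lambda>y. w y $ j) = (\<lambda>x. if x \<in> cball 0 1 then P j x else 0)" for j
    by (rule harm_ext_polynomial[OF hom_harm_polyD(3)[OF P] hom_harm_polyD(2)[OF P]]) (rule eq)
  then have "pd j (\<lambda>y. harm_ext_vec w y $ j) x = pd j (P j) x" for j
    by (intro pd_cong_open[OF open_ball x]) (simp add: harm_ext_vec_def)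
  then show ?thesis by (simp add: vdiv_def)
qed

text \<open>Moves the whole discussion to polynomials. Forwards, the divergence is homogeneous, so
  vanishing on the ball means vanishing everywhere. Backwards, both mean conditions hold because the
  components and \<open>\<langle>x, P\<rangle>\<close> are harmonic of the positive degrees
  \<open>k\<close> and \<open>k + 1\<close>.\<close>

lemma Hsol_iff:
  fixes w :: "real^'n \<Rightarrow> real^'n"
  assumes n: "CARD('n) \<ge> 2" and k: "k \<ge> 1"
  shows "w \<in> Hsol k \<longleftrightarrow> (\<exists>P. (\<forall>j. hom_harm_poly k (P j)) \<and> (\<forall>x. (\<Sum>j\<in>UNIV. pd j (P j) x) = 0) \<and>
    (\<forall>x\<in>sphere 0 1. \<forall>j. w x $ j = P j x))"
proof
  assume w: "w \<in> Hsol k"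
  then have "\<forall>j. \<exists>p. hom_harm_poly k p \<and> (\<forall>x\<in>sphere 0 1. w x $ j = p x)"
    by (simp add: Hsol_def Hnk_def sph_harm_def)
  then obtain P where P: "\<And>j. hom_harm_poly k (P j)"
    and eq: "\<And>x j. x \<in> sphere 0 1 \<Longrightarrow> w x $ j = P j x"
    unfolding choice_iff by blast
  have "hom_poly (k - 1) (\<lambda>x. \<Sum>j\<in>UNIV. pd j (P j) x)"
    by (intro hom_poly_sum hom_poly_pd hom_harm_polyD(1) P)
  moreover have "(\<Sum>j\<in>UNIV. pd j (P j) y) = 0" if "y \<in> ball 0 1" for y
  proof -
    have "vdiv (harm_ext_vec w) y = (\<Sum>j\<in>UNIV. pd j (P j) y)"
      using P eq that by (rule harm_ext_vec_divergence)
    then show ?thesis using w that by (simp add: Hsol_def)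
  qed
  ultimately have "(\<Sum>j\<in>UNIV. pd j (P j) x) = 0" for x
    by (rule hom_poly_eq_0_if_eq_0_on_ball)
  then show "\<exists>P. (\<forall>j. hom_harm_poly k (P j)) \<and> (\<forall>x. (\<Sum>j\<in>UNIV. pd j (P j) x) = 0) \<and>
    (\<forall>x\<in>sphere 0 1. \<forall>j. w x $ j = P j x)"
    using P eq by blast
next
  assume "\<exists>P. (\<forall>j. hom_harm_poly k (P j)) \<and> (\<forall>x. (\<Sum>j\<in>UNIV. pd j (P j) x) = 0) \<and>
    (\<forall>x\<in>sphere 0 1. \<forall>j. w x $ j = P j x)"
  then obtain P where P: "\<And>j. hom_harm_poly k (P j)" and div: "\<And>x. (\<Sum>j\<in>UNIV. pd j (P j) x) = 0"
    and eq: "\<And>x j. x \<in> sphere 0 1 \<Longrightarrow> w x $ j = P j x" by blast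
  have "sph_int w = sph_int (\<lambda>x. \<chi> j. P j x)"
    by (rule sph_int_cong) (simp add: vec_eq_iff eq)
  then have "sph_int w $ j = 0" for j
    using sph_int_harmonic_eq_0[OF n P k] by (simp add: sph_int_vec hom_harm_polyD(3)[OF P])
  then have "Av w = 0" by (simp add: Av_def vec_eq_iff)
  moreover have "sph_int (\<lambda>x. w x \<bullet> x) = sph_int (\<lambda>x. \<Sum>j\<in>UNIV. x $ j * P j x)"
    by (rule sph_int_cong) (simp add: inner_vec_def eq mult.commute)
  then have "Av (\<lambda>x. w x \<bullet> x) = 0"
    using sph_int_harmonic_eq_0[OF n hom_harm_poly_inner_position[OF P div]] by (simp add: Av_def)
  moreover have "sph_harm k (\<lambda>x. w x $ j)" for j
    using P eq unfolding sph_harm_def by blast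
  moreover have "vdiv (harm_ext_vec w) x = 0" if "x \<in> ball 0 1" for x
    using harm_ext_vec_divergence[where P = P and w = w, OF P _ that] eq div by simp
  ultimately show "w \<in> Hsol k"
    by (simp add: Hsol_def Hnk_def Hn_def)
qed

lemma HsolI:
  fixes w :: "real^'n \<Rightarrow> real^'n"
  assumes "CARD('n) \<ge> 2" "k \<ge> 1" "\<And>j. hom_harm_poly k (P j)" "\<And>x. (\<Sum>j\<in>UNIV. pd j (P j) x) = 0"
    and "\<And>x j. x \<in> sphere 0 1 \<Longrightarrow> w x $ j = P j x"
  shows "w \<in> Hsol k"
  using assms(3-) unfolding Hsol_iff[OF assms(1,2)] by blast

lemma Hsol_decomposition:
  fixes w :: "real^'n \<Rightarrow> real^'n"
  assumes n: "CARD('n) \<ge> 2" and k: "k \<ge> 1" and w: "w \<in> Hsol k"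
  shows "\<exists>u1\<in>H1 k. \<exists>u2\<in>H2 k. \<forall>x\<in>sphere 0 1. w x = u1 x + u2 x"
proof -
  obtain P where P: "\<And>j. hom_harm_poly k (P j)" and div: "\<And>x. (\<Sum>j\<in>UNIV. pd j (P j) x) = 0"
    and eq: "\<And>x j. x \<in> sphere 0 1 \<Longrightarrow> w x $ j = P j x"
    using w unfolding Hsol_iff[OF n k] by blast
  define f where "f x = (\<Sum>j\<in>UNIV. x $ j * P j x)" for x
  \<comment> \<open>Euler's identity in degree \<open>k + 1\<close> then gives
    \<open>\<langle>x, P1\<rangle> = f\<close>, so \<open>P1\<close> carries the whole radial part
    of \<open>P\<close>.\<close>
  define c where "c = 1 / real (Suc k)"
  define P1 where "P1 j x = c * pd j f x" for j x
  define P2 where "P2 j x = P j x - P1 j x" for j x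
  define u1 :: "real^'n \<Rightarrow> real^'n" where "u1 x = (\<chi> j. P1 j x)" for x
  \<comment> \<open>Subtracting from \<open>w\<close> rather than using \<open>P2\<close> makes the
    decomposition immediate; \<open>u2\<close> and \<open>P2\<close> need to agree on the sphere
    only.\<close>
  define u2 where "u2 x = w x - u1 x" for x
  have f: "hom_harm_poly (Suc k) f"
    unfolding f_def using P div by (rule hom_harm_poly_inner_position)
  note f' = hom_harm_polyD[OF f] and P' = hom_harm_polyD[OF P]
  have P1: "hom_harm_poly k (P1 j)" for j
    using hom_harm_poly_cmult[OF hom_harm_poly_pd[OF f]] unfolding P1_def by simp
  have P2: "hom_harm_poly k (P2 j)" for j
    unfolding P2_def using P P1 by (rule hom_harm_poly_diff)
  have div1: "(\<Sum>j\<in>UNIV. pd j (P1 j) x) = 0" for x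
  proof -
    have "(\<Sum>j\<in>UNIV. pd j (P1 j) x) = c * laplacian f x"
      unfolding P1_def by (simp add: pd_cmult real_polynomial_function_pd f'(3) laplacian_def sum_distrib_left)
    then show ?thesis by (simp add: f'(2))
  qed
  have div2: "(\<Sum>j\<in>UNIV. pd j (P2 j) x) = 0" for x
    unfolding P2_def using hom_harm_polyD(3)[OF P1]
    by (simp add: pd_diff P'(3) sum_subtractf div div1)
  have eq1: "u1 x $ j = P1 j x" for x j by (simp add: u1_def)
  have eq2: "u2 x $ j = P2 j x" if "x \<in> sphere 0 1" for x j
    using eq[OF that] by (simp add: u2_def P2_def eq1)
  have f1: "(\<Sum>j\<in>UNIV. x $ j * P1 j x) = f x" for x
  proof -
    have "(\<Sum>j\<in>UNIV. x $ j * P1 j x) = c * (\<Sum>j\<in>UNIV. x $ j * pd j f x)"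
      by (simp add: P1_def sum_distrib_left mult_ac)
    then show ?thesis by (simp add: hom_poly_euler[OF f'(1)] c_def)
  qed
  have f2: "(\<Sum>j\<in>UNIV. x $ j * P2 j x) = 0" for x
    using f1[of x] by (simp add: P2_def right_diff_distrib sum_subtractf f_def)
  have "opA u1 x = (- real k) *\<^sub>R u1 x" if x: "x \<in> sphere 0 1" for x
  proof (intro vec_eq_iff[THEN iffD2] allI)
    fix i
    have "opA u1 x $ i = - pd i f x + P1 i x"
      using opA_component[where w = u1 and P = P1, OF _ eq1 hom_harm_polyD(1)[OF P1]] x
      by (simp add: div1 f1)
    also have "pd i f x = real (Suc k) * P1 i x" by (simp add: P1_def c_def)
    finally show "opA u1 x $ i = ((- real k) *\<^sub>R u1 x) $ i" by (simp add: eq1 algebra_simps)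
  qed
  then have "u1 \<in> H1 k"
    using HsolI[OF n k P1 div1 eq1] by (simp add: H1_def)
  moreover have "opA u2 x = u2 x" if x: "x \<in> sphere 0 1" for x
  proof (intro vec_eq_iff[THEN iffD2] allI)
    fix i
    show "opA u2 x $ i = u2 x $ i"
      using opA_component[where w = u2 and P = P2, OF _ eq2 hom_harm_polyD(1)[OF P2]] x
      by (simp add: div2 f2 eq2)
  qed
  then have "u2 \<in> H2 k"
    using HsolI[OF n k P2 div2 eq2] by (simp add: H2_def)
  moreover have "w x = u1 x + u2 x" for x by (simp add: u2_def)
  ultimately show ?thesis by blast
qed

lemma Hsol_add:
  fixes u v :: "real^'n \<Rightarrow> real^'n"
  assumes n: "CARD('n) \<ge> 2" and k: "k \<ge> 1" and u: "u \<in> Hsol k" and v: "v \<in> Hsol k"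
  shows "(\<lambda>x. u x + v x) \<in> Hsol k"
proof -
  obtain P where P: "\<And>j. hom_harm_poly k (P j)" "\<And>x. (\<Sum>j\<in>UNIV. pd j (P j) x) = 0"
    "\<And>x j. x \<in> sphere 0 1 \<Longrightarrow> u x $ j = P j x"
    using u unfolding Hsol_iff[OF n k] by blast
  obtain Q where Q: "\<And>j. hom_harm_poly k (Q j)" "\<And>x. (\<Sum>j\<in>UNIV. pd j (Q j) x) = 0"
    "\<And>x j. x \<in> sphere 0 1 \<Longrightarrow> v x $ j = Q j x"
    using v unfolding Hsol_iff[OF n k] by blast
  show ?thesis
  proof (rule HsolI[OF n k])
    show "hom_harm_poly k (\<lambda>x. P j x + Q j x)" for j
      using P(1) Q(1) by (rule hom_harm_poly_add)
    show "(\<Sum>j\<in>UNIV. pd j (\<lambda>x. P j x + Q j x) x) = 0" for x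
      using P(2) Q(2) by (simp add: pd_add hom_harm_polyD(3)[OF P(1)] hom_harm_polyD(3)[OF Q(1)] sum.distrib)
  qed (simp add: P(3) Q(3))
qed

text \<open>In a fixed degree the \<open>W^{1,2}\<close> product is a multiple of the
  \<open>L^2\<close> product. Removing the radial parts from the gradients costs
  \<open>k^2 P Q\<close>, and with \<open>sph_int_grad_harmonic\<close> the total factor is
  \<open>1 - k^2 + k (n + 2 k - 2) = 1 + k (n + k - 2)\<close>.\<close>

lemma ip12_harmonic:
  fixes u v :: "real^'n \<Rightarrow> real^'n"
  assumes P: "\<And>j. hom_harm_poly k (P j)" and Q: "\<And>j. hom_harm_poly k (Q j)"
    and u: "\<And>x j. x \<in> sphere 0 1 \<Longrightarrow> u x $ j = P j x"
    and v: "\<And>x j. x \<in> sphere 0 1 \<Longrightarrow> v x $ j = Q j x"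
  shows "ip12 u v = (1 + k * (real CARD('n) + real k - 2)) * sph_int (\<lambda>x. \<Sum>j\<in>UNIV. P j x * Q j x)"
proof -
  note P' = hom_harm_polyD[OF P] and Q' = hom_harm_polyD[OF Q]
  let ?I = "\<lambda>x j. (1 - (real k)\<^sup>2) * (P j x * Q j x) + (\<Sum>i\<in>UNIV. pd i (P j) x * pd i (Q j) x)"
  have I: "real_polynomial_function (\<lambda>x. ?I x j)" for j
    by (simp add: rpf_intros P' Q' real_polynomial_function_pd)
  have "ip12 u v = sph_int (\<lambda>x. \<Sum>j\<in>UNIV. ?I x j)"
    unfolding ip12_def
  proof (rule sph_int_cong)
    fix x :: "real^'n" assume x: "x \<in> sphere 0 1"
    then have n: "norm x = 1" by simp
    have grad: "gradT (\<lambda>y. u y $ j) x \<bullet> gradT (\<lambda>y. v y $ j) x =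
        (\<Sum>i\<in>UNIV. pd i (P j) x * pd i (Q j) x) - (real k)\<^sup>2 * (P j x * Q j x)" for j
    proof -
      let ?p = "(\<chi> i. pd i (P j) x) :: real^'n" and ?q = "(\<chi> i. pd i (Q j) x) :: real^'n"
      have eqs: "x \<bullet> x = 1" "x \<bullet> ?p = k * P j x" "?q \<bullet> x = k * Q j x" "?p \<bullet> x = k * P j x" "x \<bullet> ?q = k * Q j x"
        using hom_poly_euler[OF P'(1), of x j] hom_poly_euler[OF Q'(1), of x j]
        n by (simp_all add: inner_vec_def mult.commute norm_eq_1)
      have pq: "?p \<bullet> ?q = (\<Sum>i\<in>UNIV. pd i (P j) x * pd i (Q j) x)"
        by (simp add: inner_vec_def)
      have gu: "gradT (\<lambda>y. u y $ j) x = ?p - (k * P j x) *\<^sub>R x"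
        by (rule gradT_eq[OF n _ P'(1)]) (rule u)
      have gv: "gradT (\<lambda>y. v y $ j) x = ?q - (k * Q j x) *\<^sub>R x"
        by (rule gradT_eq[OF n _ Q'(1)]) (rule v)
      show ?thesis
        by (simp only: gu gv inner_diff_left inner_diff_right inner_scaleR_left inner_scaleR_right eqs pq)
          (simp add: power2_eq_square)
    qed
    have "u x \<bullet> v x = (\<Sum>j\<in>UNIV. P j x * Q j x)"
      using x by (simp add: inner_vec_def u v)
    then show "u x \<bullet> v x + (\<Sum>j\<in>UNIV. gradT (\<lambda>y. u y $ j) x \<bullet> gradT (\<lambda>y. v y $ j) x) = (\<Sum>j\<in>UNIV. ?I x j)"
      by (simp add: grad left_diff_distrib algebra_simps flip: sum.distrib)
  qed
  also have "\<dots> = (\<Sum>j\<in>UNIV. sph_int (\<lambda>x. ?I x j))"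
    by (simp add: sph_int_sum I)
  also have "\<dots> = (\<Sum>j\<in>UNIV. (1 + k * (real CARD('n) + real k - 2)) * sph_int (\<lambda>x. P j x * Q j x))"
  proof (rule sum.cong[OF refl])
    fix j
    have "sph_int (\<lambda>x. ?I x j) = (1 - (real k)\<^sup>2) * sph_int (\<lambda>x. P j x * Q j x) +
        sph_int (\<lambda>x. \<Sum>i\<in>UNIV. pd i (P j) x * pd i (Q j) x)"
      by (subst sph_int_add) (simp_all add: sph_int_cmult rpf_intros P' Q' real_polynomial_function_pd)
    then show "sph_int (\<lambda>x. ?I x j) =
        (1 + k * (real CARD('n) + real k - 2)) * sph_int (\<lambda>x. P j x * Q j x)"
      unfolding sph_int_grad_harmonic[OF P Q] by (simp add: power2_eq_square algebra_simps)
  qed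
  also have "\<dots> = (1 + k * (real CARD('n) + real k - 2)) * sph_int (\<lambda>x. \<Sum>j\<in>UNIV. P j x * Q j x)"
    by (simp add: sph_int_sum rpf_intros P' Q' sum_distrib_left)
  finally show ?thesis .
qed

section \<open>The complement of the solenoidal maps\<close>

text \<open>\<open>W\<close> is the harmonic projection of \<open>x q\<close>; as \<open>q\<close> varies, these maps make up the
  complement of the solenoidal maps. The constant \<open>m\<close> is chosen so that \<open>\<Delta>(|x|\<^sup>2 g) = 2 m g\<close> for
  \<open>g = \<partial>\<^sub>j q\<close>. For \<open>k = 1\<close> the degree \<open>k - 1 - 1\<close> of \<open>g\<close> is truncated, but then \<open>g = 0\<close>.\<close>

locale harmonic_projection =
  fixes q :: "real^'n \<Rightarrow> real" and k :: nat and m :: real and W :: "'n \<Rightarrow> real^'n \<Rightarrow> real"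
  assumes n: "CARD('n) \<ge> 3" and k: "k \<ge> 1" and q: "hom_harm_poly (k - 1) q"
  defines "m \<equiv> 2 * real k + real CARD('n) - 4"
    and "W \<equiv> \<lambda>j x. x $ j * q x - (norm x)\<^sup>2 * pd j q x / m"
begin

lemma m_pos: "m > 0"
  using n k by (simp add: m_def)

lemma rpf_q: "real_polynomial_function q"
  using q by (rule hom_harm_polyD)

lemma rpf_norm_square: "real_polynomial_function (\<lambda>x::real^'n. (norm x)\<^sup>2)"
  by (rule real_polynomial_function_hom_poly[OF hom_poly_norm_square])

lemma W_eq: "W j = (\<lambda>x. x $ j * q x - (1 / m) * ((norm x)\<^sup>2 * pd j q x))"
  by (simp add: W_def)

lemma pd_q_eq_0: "k = 1 \<Longrightarrow> pd j q = (\<lambda>x. 0)"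
  using hom_poly_0_const[of q j] hom_harm_polyD(1)[OF q] by simp

lemma euler_q: "(\<Sum>i\<in>UNIV. x $ i * pd i q x) = (real k - 1) * q x"
  using hom_poly_euler[OF hom_harm_polyD(1)[OF q]] k by (simp add: of_nat_diff)

lemma laplacian_norm_square: "laplacian (\<lambda>x::real^'n. (norm x)\<^sup>2) x = 2 * CARD('n)"
  by (simp add: laplacian_def pd_norm_square pd_cmult[OF real_polynomial_function_component] pd_component)

lemma laplacian_norm_square_mult_pd: "laplacian (\<lambda>x. (norm x)\<^sup>2 * pd j q x) x = 2 * m * pd j q x"
proof (cases "k = 1")
  case True
  then show ?thesis by (simp add: pd_q_eq_0 laplacian_def)
next
  case False
  then have g: "hom_harm_poly (k - 2) (pd j q)"
    using hom_harm_poly_pd[OF q, of j] by (simp add: numeral_2_eq_2)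
  have "laplacian (\<lambda>x. (norm x)\<^sup>2 * pd j q x) x =
      2 * CARD('n) * pd j q x + 4 * (\<Sum>i\<in>UNIV. x $ i * pd i (pd j q) x)"
    unfolding laplacian_mult[OF rpf_norm_square hom_harm_polyD(3)[OF g]]
    by (simp add: hom_harm_polyD(2)[OF g] laplacian_norm_square pd_norm_square sum_distrib_left mult_ac)
  \<comment> \<open>The factor is \<open>2 n + 4 (k - 2) = 2 m\<close>, by Euler's identity in
    degree \<open>k - 2\<close>.\<close>
  then show ?thesis
    using False k by (simp add: hom_poly_euler[OF hom_harm_polyD(1)[OF g]] m_def of_nat_diff algebra_simps)
qed

lemma hom_harm_poly_W: "hom_harm_poly k (W j)"
proof -
  have xq: "hom_poly k (\<lambda>x. x $ j * q x)"
    using hom_poly_mult[OF hom_poly_component hom_harm_polyD(1)[OF q], of j] k by simp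
  have nq: "hom_poly k (\<lambda>x. (norm x)\<^sup>2 * pd j q x)"
  proof (cases "k = 1")
    case True
    then show ?thesis by (simp add: pd_q_eq_0 hom_poly_zero)
  next
    case False
    then have "2 + (k - 1 - 1) = k" using k by simp
    then show ?thesis
      using hom_poly_mult[OF hom_poly_norm_square hom_poly_pd[OF hom_harm_polyD(1)[OF q]], of j]
      by metis
  qed
  have "laplacian (\<lambda>x. x $ j) x = 0" for x :: "real^'n"
    by (simp add: laplacian_def pd_component)
  then have "laplacian (\<lambda>x. x $ j * q x) x = 2 * pd j q x" for x
    by (simp add: laplacian_mult rpf_q real_polynomial_function_component pd_component
        mult_delta_left hom_harm_polyD(2)[OF q])
  moreover have "W j = (\<lambda>x. x $ j * q x + (- 1 / m) * ((norm x)\<^sup>2 * pd j q x))"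
    by (simp add: W_def)
  \<comment> \<open>Both terms contribute \<open>2 * pd j q x\<close>, with opposite signs.\<close>
  ultimately have "laplacian (W j) x = 0" for x
    using m_pos real_polynomial_function_hom_poly[OF xq] real_polynomial_function_hom_poly[OF nq]
    by (simp only: laplacian_add laplacian_cmult laplacian_norm_square_mult_pd
        real_polynomial_function.intros) simp
  moreover have "hom_poly k (W j)"
    unfolding W_eq using xq nq by (intro hom_poly_diff hom_poly_cmult)
  ultimately show ?thesis by (simp add: hom_harm_poly_def)
qed

lemma divergence_W: "(\<Sum>j\<in>UNIV. pd j (W j) x) =
  (real CARD('n) + real k - 1 - 2 * (real k - 1) / m) * q x"
proof -
  have "pd j (W j) x = q x + x $ j * pd j q x -
      (1 / m) * (2 * (x $ j * pd j q x) + (norm x)\<^sup>2 * pd j (pd j q) x)" for j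
    unfolding W_eq
    by (subst pd_diff)
      (simp_all add: pd_cmult pd_mult pd_component pd_norm_square rpf_q rpf_norm_square
        real_polynomial_function_pd real_polynomial_function_component real_polynomial_function.intros mult_ac
        del: times_divide_eq_left)
  then have "(\<Sum>j\<in>UNIV. pd j (W j) x) = CARD('n) * q x + (\<Sum>j\<in>UNIV. x $ j * pd j q x) -
      (1 / m) * (2 * (\<Sum>j\<in>UNIV. x $ j * pd j q x) + (norm x)\<^sup>2 * laplacian q x)"
    by (simp only: sum.distrib sum_subtractf flip: sum_distrib_left laplacian_def) simp
  then show ?thesis
    using m_pos by (simp only: euler_q hom_harm_polyD(2)[OF q]) (simp add: field_simps)
qed

text \<open>Since \<open>m - 2 (k - 1) = n - 2\<close> is positive, the subtracted quotient is below
  1. Positivity allows \<open>q\<close> to be normalised so that \<open>W\<close> attains a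
  prescribed divergence.\<close>

lemma divergence_factor_pos: "real CARD('n) + real k - 1 - 2 * (real k - 1) / m > 0"
proof -
  have "2 * (real k - 1) < m" using n by (simp add: m_def)
  then have "2 * (real k - 1) / m < 1" using m_pos by simp
  then show ?thesis using n k by linarith
qed

lemma inner_position_W: "(\<Sum>j\<in>UNIV. x $ j * W j x) = (1 - (real k - 1) / m) * ((norm x)\<^sup>2 * q x)"
proof -
  have "(\<Sum>j\<in>UNIV. x $ j * x $ j) = (norm x)\<^sup>2"
    by (simp add: norm_vec_def L2_set_def power2_eq_square sum_nonneg)
  moreover have "(\<Sum>j\<in>UNIV. x $ j * W j x) = (\<Sum>j\<in>UNIV. x $ j * x $ j) * q x -
      (1 / m) * (norm x)\<^sup>2 * (\<Sum>j\<in>UNIV. x $ j * pd j q x)"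
    unfolding W_eq by (simp add: sum_distrib_left sum_distrib_right right_diff_distrib sum_subtractf mult_ac)
  ultimately show ?thesis
    by (simp add: euler_q algebra_simps)
qed

lemma opA_W:
  fixes w :: "real^'n \<Rightarrow> real^'n"
  assumes x: "x \<in> sphere 0 1" and w: "\<And>x j. x \<in> sphere 0 1 \<Longrightarrow> w x $ j = W j x"
  shows "opA w x = (real k + real CARD('n) - 2) *\<^sub>R w x"
proof (intro vec_eq_iff[THEN iffD2] allI)
  fix i
  \<comment> \<open>The coefficient in \<open>\<langle>x, W\<rangle> = a |x|^2 q\<close>. Expressing
    the divergence factor through \<open>a\<close> makes \<open>a\<close> drop out of the
    coefficient of \<open>x $ i * q x\<close>.\<close>
  define a where "a = 1 - (real k - 1) / m"
  have "pd i (\<lambda>x. \<Sum>j\<in>UNIV. x $ j * W j x) x = a * (2 * x $ i * q x + pd i q x)"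
    unfolding inner_position_W a_def[symmetric] using x
    by (simp add: pd_cmult pd_mult rpf_q rpf_norm_square real_polynomial_function.intros pd_norm_square)
  then have "opA w x $ i = (real CARD('n) + real k - 1 - 2 * (real k - 1) / m) * q x * x $ i -
      a * (2 * x $ i * q x + pd i q x) + W i x"
    using opA_component[where w = w and P = W, OF _ w hom_harm_polyD(1)[OF hom_harm_poly_W], of x i] x
    by (simp add: divergence_W)
  also have "W i x = x $ i * q x - (1 / m) * pd i q x" using x by (simp add: W_def)
  also have "2 * (real k - 1) / m = 2 - 2 * a" by (simp add: a_def)
  finally have "opA w x $ i =
      (real k + real CARD('n) - 2) * (x $ i * q x) - (a + 1 / m) * pd i q x"
    by (simp add: algebra_simps)
  \<comment> \<open>Here \<open>m - k + 2 = k + n - 2\<close>, so both coefficients are multiples of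
    the eigenvalue.\<close>
  also have "a + 1 / m = (real k + real CARD('n) - 2) / m"
    using m_pos by (simp add: a_def field_simps) (simp add: m_def)
  also have "(real k + real CARD('n) - 2) * (x $ i * q x) - (real k + real CARD('n) - 2) / m * pd i q x =
      (real k + real CARD('n) - 2) * W i x"
    using x by (simp add: W_def right_diff_distrib)
  finally show "opA w x $ i = ((real k + real CARD('n) - 2) *\<^sub>R w x) $ i"
    using w[OF x] by simp
qed

text \<open>On the sphere \<open>\<langle>W, V\<rangle>\<close> is
  \<open>q \<langle>x, V\<rangle>\<close> minus a multiple of
  \<open>\<langle>\<nabla>q, V\<rangle>\<close>. The first pairs the degrees \<open>k - 1\<close>
  and \<open>k + 1\<close>, the second \<open>k - 1 - 1\<close> and \<open>k\<close>; these differ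
  even after truncation.\<close>

lemma sph_int_W_orthogonal:
  assumes V: "\<And>j. hom_harm_poly k (V j)" and div: "\<And>x. (\<Sum>j\<in>UNIV. pd j (V j) x) = 0"
  shows "sph_int (\<lambda>x. \<Sum>j\<in>UNIV. W j x * V j x) = 0"
proof -
  let ?f = "\<lambda>x. \<Sum>j\<in>UNIV. x $ j * V j x"
  note rpf_V = hom_harm_polyD(3)[OF V]
  have f: "hom_harm_poly (Suc k) ?f"
    using V div by (rule hom_harm_poly_inner_position)
  have "sph_int (\<lambda>x. \<Sum>j\<in>UNIV. W j x * V j x) =
      sph_int (\<lambda>x. q x * ?f x - (1 / m) * (\<Sum>j\<in>UNIV. pd j q x * V j x))"
    by (rule sph_int_cong)
      (simp add: W_def left_diff_distrib right_diff_distrib sum_subtractf sum_distrib_left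
        sum_divide_distrib mult_ac)
  also have "\<dots> = sph_int (\<lambda>x. q x * ?f x) - (1 / m) * (\<Sum>j\<in>UNIV. sph_int (\<lambda>x. pd j q x * V j x))"
    by (subst sph_int_diff)
      (simp_all add: sph_int_cmult sph_int_sum rpf_q rpf_V hom_harm_polyD(3)[OF f] rpf_intros
        real_polynomial_function_pd del: times_divide_eq_left)
  also have "\<dots> = 0"
    using n k sph_int_harmonic_orthogonal[OF _ q f] sph_int_harmonic_orthogonal[OF _ hom_harm_poly_pd[OF q] V]
    by simp
  finally show ?thesis .
qed

end

lemma Hsol_perp_opA:
  fixes w :: "real^'n \<Rightarrow> real^'n"
  assumes n: "CARD('n) \<ge> 3" and k: "k \<ge> 1" and w: "w \<in> Hsol_perp k" and x: "x \<in> sphere 0 1"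
  shows "opA w x = (real k + real CARD('n) - 2) *\<^sub>R w x"
proof -
  have n2: "CARD('n) \<ge> 2" using n by simp
  have "\<forall>j. \<exists>p. hom_harm_poly k p \<and> (\<forall>x\<in>sphere 0 1. w x $ j = p x)"
    using w by (simp add: Hsol_perp_def Hnk_def sph_harm_def)
  then obtain P where P: "\<And>j. hom_harm_poly k (P j)"
    and eq: "\<And>x j. x \<in> sphere 0 1 \<Longrightarrow> w x $ j = P j x"
    unfolding choice_iff by blast
  define m where "m = 2 * real k + real CARD('n) - 4"
  define c where "c = real CARD('n) + real k - 1 - 2 * (real k - 1) / m"
  \<comment> \<open>Dividing by the divergence factor makes the divergence of \<open>W\<close> equal
    to that of \<open>P\<close>.\<close>
  define q where "q x = (1 / c) * (\<Sum>j\<in>UNIV. pd j (P j) x)" for x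
  define W where "W j x = x $ j * q x - (norm x)\<^sup>2 * pd j q x / m" for j x
  have "hom_harm_poly (k - 1) q"
    unfolding q_def by (intro hom_harm_poly_cmult hom_harm_poly_sum hom_harm_poly_pd P) simp
  then interpret harmonic_projection q k m W
    using n k unfolding harmonic_projection_def atomize_eq by (simp_all add: m_def W_def[abs_def])
  have divW: "(\<Sum>j\<in>UNIV. pd j (W j) x) = (\<Sum>j\<in>UNIV. pd j (P j) x)" for x
    using divergence_W[of x] divergence_factor_pos by (simp add: q_def c_def)
  define V where "V j x = P j x - W j x" for j x
  have V: "hom_harm_poly k (V j)" for j
    unfolding V_def using P hom_harm_poly_W by (rule hom_harm_poly_diff)
  have divV: "(\<Sum>j\<in>UNIV. pd j (V j) x) = 0" for x
    unfolding V_def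
    by (simp add: pd_diff hom_harm_polyD(3)[OF P] hom_harm_polyD(3)[OF hom_harm_poly_W] sum_subtractf divW)
  note rpf = hom_harm_polyD(3)[OF V] hom_harm_polyD(3)[OF hom_harm_poly_W]
  define v :: "real^'n \<Rightarrow> real^'n" where "v x = (\<chi> j. V j x)" for x
  have v: "v x $ j = V j x" for x j by (simp add: v_def)
  have "v \<in> Hsol k" using n2 k V divV v by (rule HsolI)
  then have "ip12 w v = 0" using w by (simp add: Hsol_perp_def)
  moreover have "ip12 w v = (1 + k * (real CARD('n) + real k - 2)) *
      sph_int (\<lambda>x. \<Sum>j\<in>UNIV. P j x * V j x)"
    using P V eq v by (rule ip12_harmonic)
  moreover have "1 + k * (real CARD('n) + real k - 2) > 0"
    using n k by (intro add_pos_nonneg mult_nonneg_nonneg) auto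
  ultimately have "sph_int (\<lambda>x. \<Sum>j\<in>UNIV. P j x * V j x) = 0" by simp
  \<comment> \<open>With \<open>P = V + W\<close> and \<open>W\<close> orthogonal to
    \<open>V\<close>, the vanishing product of \<open>P\<close> and \<open>V\<close> is the integral
    of \<open>|V|^2\<close>, which forces \<open>V = 0\<close>.\<close>
  moreover have "(\<lambda>x. \<Sum>j\<in>UNIV. P j x * V j x) =
      (\<lambda>x. (\<Sum>j\<in>UNIV. V j x * V j x) + (\<Sum>j\<in>UNIV. W j x * V j x))"
    by (simp add: V_def left_diff_distrib flip: sum.distrib)
  ultimately have int0: "sph_int (\<lambda>x. \<Sum>j\<in>UNIV. V j x * V j x) = 0"
    using sph_int_W_orthogonal[OF V divV] by (simp add: sph_int_add rpf rpf_intros)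
  have hp: "hom_poly (k + k) (\<lambda>x. \<Sum>j\<in>UNIV. V j x * V j x)"
    by (intro hom_poly_sum hom_poly_mult hom_harm_polyD(1) V)
  have "(\<Sum>j\<in>UNIV. V j x * V j x) = 0" for x
    by (rule hom_poly_eq_0_if_sph_int_eq_0[OF hp _ int0]) (simp add: sum_nonneg)
  then have "V j x = 0" for j x
    by (simp add: sum_nonneg_eq_0_iff)
  then have "w x $ j = W j x" if "x \<in> sphere 0 1" for x j
    using eq[OF that] by (simp add: V_def)
  then show ?thesis using x by (intro opA_W)
qed

text \<open>Maps on the sphere are represented by functions on the whole space, so equalities
  between maps are asserted on the unit sphere. The direct sum is split into existence of the
  decomposition, the reverse inclusion and trivial intersection.\<close>

theorem theorem4p7:
  fixes k :: nat
  assumes "CARD('n::finite) \<ge> 3" and "k \<ge> 1"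
  shows "((\<forall>w\<in>(Hsol k :: (real^'n \<Rightarrow> real^'n) set).
             \<exists>u1\<in>H1 k. \<exists>u2\<in>H2 k. \<forall>x\<in>sphere 0 1. w x = u1 x + u2 x)
        \<and> (\<forall>u1\<in>(H1 k :: (real^'n \<Rightarrow> real^'n) set). \<forall>u2\<in>H2 k. (\<lambda>x. u1 x + u2 x) \<in> Hsol k)
        \<and> (\<forall>u\<in>(H1 k :: (real^'n \<Rightarrow> real^'n) set) \<inter> H2 k. \<forall>x\<in>sphere 0 1. u x = 0))
      \<and> (\<forall>w\<in>(Hsol_perp k :: (real^'n \<Rightarrow> real^'n) set). \<forall>x\<in>sphere 0 1.
             opA w x = (real k + real CARD('n) - 2) *\<^sub>R w x)"
proof (intro conjI ballI)
  have n: "CARD('n) \<ge> 2" using assms(1) by simp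
  show "\<exists>u1\<in>H1 k. \<exists>u2\<in>H2 k. \<forall>x\<in>sphere 0 1. w x = u1 x + u2 x"
    if "w \<in> Hsol k" for w :: "real^'n \<Rightarrow> real^'n"
    using n assms(2) that by (rule Hsol_decomposition)
  show "(\<lambda>x. u1 x + u2 x) \<in> Hsol k" if "u1 \<in> H1 k" "u2 \<in> H2 k" for u1 u2 :: "real^'n \<Rightarrow> real^'n"
    using that Hsol_add[OF n assms(2)] by (simp add: H1_def H2_def)
  show "u x = 0" if "u \<in> H1 k \<inter> H2 k" "x \<in> sphere 0 1" for u :: "real^'n \<Rightarrow> real^'n" and x
  proof -
    have "opA u x = (- real k) *\<^sub>R u x" "opA u x = u x"
      using that unfolding H1_def H2_def by blast+
    \<comment> \<open>A common eigenvector for the distinct eigenvalues \<open>-k\<close> and 1 must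
      vanish.\<close>
    then have "u x = (- real k) *\<^sub>R u x" by simp
    then have "(1 + real k) *\<^sub>R u x = 0" by (simp add: scaleR_left_distrib eq_neg_iff_add_eq_0)
    then show ?thesis by simp
  qed
  show "opA w x = (real k + real CARD('n) - 2) *\<^sub>R w x"
    if "w \<in> Hsol_perp k" "x \<in> sphere 0 1" for w :: "real^'n \<Rightarrow> real^'n" and x
    using assms that by (rule Hsol_perp_opA)
qed

end
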